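(* Let $\Gamma$ be a finitely generated cocompact lattice of a tdlc group $G$, and let $C$ be a dense subgroup of $G$ such that $\Gamma\leq C\leq\mathrm{Comm}_G(\Gamma)$. Suppose: (1) $G$ admits a compact open subgroup with trivial normal core in $G$; (2) every closed normal subgroup $N$ of $G$ satisfies the following alternative: either there exists a compact subgroup $K$ of $N$ such that $K$ is open in $N$ and $K$ is normal in $G$, or $\mathrm{Res}(G)\leq N$; (3) for every closed subgroup $J$ of $G$ satisfying $\mathrm{Res}(G)\leq J$, the group $J$ is not locally finitely generated. Then every finitely generated commensurated subgroup of $C$ is virtually contained in $\Gamma$.
   Context: A tdlc group is a totally disconnected locally compact group. A cocompact lattice of a locally compact group $G$ is a discrete subgroup $\Gamma$ of $G$ such that $G/\Gamma$ is compact. Two subgroups of a group are commensurable if their intersection has finite index in each of them. $\mathrm{Comm}_G(\Gamma)$ is the set of $g\in G$ such that $\Gamma$ and $g\Gamma g^{-1}$ are commensurable. A subgroup $H$ of a group $C$ is commensurated in $C$ if $H$ and $cHc^{-1}$ are commensurable for every $c\in C$. $H$ is virtually contained in $\Gamma$ if some finite index subgroup of $H$ is contained in $\Gamma$. The normal core of a subgroup $L$ of $G$ is $\bigcap_{g\in G}gLg^{-1}$. The discrete residual $\mathrm{Res}(G)$ is the intersection of all open normal subgroups of $G$. A profinite group is finitely generated if it has a dense finitely generated subgroup; a tdlc group is locally finitely generated if some (equivalently every) compact open subgroup of it is a finitely generated profinite group. *)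

theory Defs
  imports "HOL-Analysis.Analysis" "HOL-Algebra.Generated_Groups"
begin

section \<open>Quotient topologies and total disconnectedness\<close>

definition quotient_topology :: "'a topology \<Rightarrow> ('a \<Rightarrow> 'b) \<Rightarrow> 'b topology" where
  "quotient_topology X f =
     topology (\<lambda>U. U \<subseteq> f ` topspace X \<and> openin X {x \<in> topspace X. f x \<in> U})"

lemma openin_quotient_topology:
  "openin (quotient_topology X f) U \<longleftrightarrow>
     U \<subseteq> f ` topspace X \<and> openin X {x \<in> topspace X. f x \<in> U}"
proof -
  let ?L = "\<lambda>U. U \<subseteq> f ` topspace X \<and> openin X {x \<in> topspace X. f x \<in> U}"
  have Int: "?L (S \<inter> T)" if "?L S" "?L T" for S T
  proof -
    have "{x \<in> topspace X. f x \<in> S \<inter> T} =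
        {x \<in> topspace X. f x \<in> S} \<inter> {x \<in> topspace X. f x \<in> T}" by blast
    then show ?thesis
      using that openin_Int[of X "{x \<in> topspace X. f x \<in> S}" "{x \<in> topspace X. f x \<in> T}"]
      by (simp only:) blast
  qed
  have Un: "?L (\<Union>\<K>)" if \<K>: "\<forall>K\<in>\<K>. ?L K" for \<K>
  proof -
    have eq: "{x \<in> topspace X. f x \<in> \<Union>\<K>} = \<Union>((\<lambda>K. {x \<in> topspace X. f x \<in> K}) ` \<K>)"
      by blast
    have "openin X (\<Union>((\<lambda>K. {x \<in> topspace X. f x \<in> K}) ` \<K>))"
      by (rule openin_Union) (use \<K> in blast)
    then show ?thesis
      unfolding eq using \<K> by blast
  qed
  have "istopology ?L"
    unfolding istopology_def using Int Un by blast
  from topology_inverse'[OF this] show ?thesis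
    unfolding quotient_topology_def by (rule fun_cong)
qed

lemma topspace_quotient_topology: "topspace (quotient_topology X f) = f ` topspace X"
proof
  show "topspace (quotient_topology X f) \<subseteq> f ` topspace X"
    using openin_topspace[of "quotient_topology X f"] unfolding openin_quotient_topology
    by (rule conjunct1)
  have "{x \<in> topspace X. f x \<in> f ` topspace X} = topspace X" by blast
  then have "openin (quotient_topology X f) (f ` topspace X)"
    unfolding openin_quotient_topology by (simp only:) simp
  then show "f ` topspace X \<subseteq> topspace (quotient_topology X f)" by (rule openin_subset)
qed

lemma quotient_map_quotient_topology: "quotient_map X (quotient_topology X f) f"
  unfolding quotient_map_def topspace_quotient_topology openin_quotient_topology
  by (intro conjI refl allI impI iffI) simp_all

definition totally_disconnected_space :: "'a topology \<Rightarrow> bool" where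
  "totally_disconnected_space X \<longleftrightarrow> (\<forall>S. connectedin X S \<longrightarrow> (\<forall>x\<in>S. \<forall>y\<in>S. x = y))"


section \<open>Topological groups\<close>

text \<open>
  A group is a HOL-Algebra structure \<open>G\<close> together with a topology \<open>T\<close> on its carrier.
  A subgroup \<open>H\<close> of \<open>G\<close> is regarded as a group in its own right as \<open>G\<lparr>carrier := H\<rparr>\<close>, and
  as a topological group with the topology \<open>subtopology T H\<close>.
\<close>

locale topological_group = group G for G (structure) +
  fixes T
  assumes topspace_eq_carrier: "topspace T = carrier G"
    and continuous_map_mult: "continuous_map (prod_topology T T) T (\<lambda>(x, y). x \<otimes> y)"
    and continuous_map_inv: "continuous_map T T (\<lambda>x. inv x)"

locale tdlc_group = topological_group +
  assumes Hausdorff: "Hausdorff_space T"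
    and locally_compact: "locally_compact_space T"
    and totally_disconnected: "totally_disconnected_space T"

locale profinite_group = topological_group +
  assumes Hausdorff: "Hausdorff_space T"
    and compact: "compact_space T"
    and totally_disconnected: "totally_disconnected_space T"


section \<open>Finite generation\<close>

definition finitely_generated_group :: "('a, 'm) monoid_scheme \<Rightarrow> bool" where
  "finitely_generated_group G \<longleftrightarrow>
     (\<exists>S. finite S \<and> S \<subseteq> carrier G \<and> generate G S = carrier G)"

text \<open>For profinite groups, finite generation is meant topologically.\<close>

definition fg_profinite_group :: "('a, 'm) monoid_scheme \<Rightarrow> 'a topology \<Rightarrow> bool" where
  "fg_profinite_group G T \<longleftrightarrow>
     profinite_group G T \<and>
     (\<exists>D. subgroup D G \<and> finitely_generated_group (G\<lparr>carrier := D\<rparr>) \<and>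
          T closure_of D = carrier G)"

definition locally_finitely_generated :: "('a, 'm) monoid_scheme \<Rightarrow> 'a topology \<Rightarrow> bool" where
  "locally_finitely_generated G T \<longleftrightarrow>
     (\<exists>U. subgroup U G \<and> compactin T U \<and> openin T U \<and>
          fg_profinite_group (G\<lparr>carrier := U\<rparr>) (subtopology T U))"


section \<open>Commensurability\<close>

definition conjugate_set :: "('a, 'm) monoid_scheme \<Rightarrow> 'a \<Rightarrow> 'a set \<Rightarrow> 'a set" where
  "conjugate_set G g H = g <#\<^bsub>G\<^esub> H #>\<^bsub>G\<^esub> inv\<^bsub>G\<^esub> g"

definition finite_index_subgroup :: "'a set \<Rightarrow> ('a, 'm) monoid_scheme \<Rightarrow> bool" where
  "finite_index_subgroup K G \<longleftrightarrow> subgroup K G \<and> finite (rcosets\<^bsub>G\<^esub> K)"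

definition commensurable :: "('a, 'm) monoid_scheme \<Rightarrow> 'a set \<Rightarrow> 'a set \<Rightarrow> bool" where
  "commensurable G H K \<longleftrightarrow>
     finite_index_subgroup (H \<inter> K) (G\<lparr>carrier := H\<rparr>) \<and>
     finite_index_subgroup (H \<inter> K) (G\<lparr>carrier := K\<rparr>)"

definition commensurator :: "('a, 'm) monoid_scheme \<Rightarrow> 'a set \<Rightarrow> 'a set" where
  "commensurator G H = {g \<in> carrier G. commensurable G H (conjugate_set G g H)}"

definition commensurated :: "('a, 'm) monoid_scheme \<Rightarrow> 'a set \<Rightarrow> bool" where
  "commensurated C H \<longleftrightarrow>
     subgroup H C \<and> (\<forall>c\<in>carrier C. commensurable C H (conjugate_set C c H))"

definition virtually_contained :: "('a, 'm) monoid_scheme \<Rightarrow> 'a set \<Rightarrow> 'a set \<Rightarrow> bool" where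
  "virtually_contained G H K \<longleftrightarrow>
     (\<exists>H'. finite_index_subgroup H' (G\<lparr>carrier := H\<rparr>) \<and> H' \<subseteq> K)"


section \<open>Lattices, normal core and discrete residual\<close>

text \<open>The quotient of \<open>G\<close> by \<open>\<Gamma>\<close> is the space of left cosets with the quotient topology.\<close>

definition cocompact_lattice :: "('a, 'm) monoid_scheme \<Rightarrow> 'a topology \<Rightarrow> 'a set \<Rightarrow> bool" where
  "cocompact_lattice G T \<Gamma> \<longleftrightarrow>
     subgroup \<Gamma> G \<and> subtopology T \<Gamma> = discrete_topology \<Gamma> \<and>
     compact_space (quotient_topology T (\<lambda>g. g <#\<^bsub>G\<^esub> \<Gamma>))"

definition normal_core :: "('a, 'm) monoid_scheme \<Rightarrow> 'a set \<Rightarrow> 'a set" where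
  "normal_core G L = (\<Inter>g\<in>carrier G. conjugate_set G g L)"

definition discrete_residual :: "('a, 'm) monoid_scheme \<Rightarrow> 'a topology \<Rightarrow> 'a set" where
  "discrete_residual G T = \<Inter>{N. N \<lhd> G \<and> openin T N}"

end

theory Submission
  imports Defs
begin

text \<open>
  Let \<open>H\<close> be a finitely generated commensurated subgroup of \<open>C\<close>. The idea is to approximate, from
  above, what \<open>\<Gamma>\<close> and \<open>H\<close> have in common up to finite index: call a closed subgroup \<open>L\<close> of \<open>G\<close> an
  \<^emph>\<open>approximant\<close> if it contains finite index subgroups of both \<open>\<Gamma>\<close> and \<open>H\<close>. Since \<open>C\<close> commensurates
  \<open>\<Gamma>\<close> and \<open>H\<close>, conjugation by elements of \<open>C\<close> permutes the approximants, so their intersection \<open>M\<close> is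
  normalised by \<open>C\<close>, and being closed it is normalised by the closure of \<open>C\<close>, which is \<open>G\<close>.

  The closure \<open>J\<close> of \<open>\<langle>\<Gamma>, H\<rangle>\<close> is an approximant, and it is locally finitely generated: a
  finitely generated group \<open>\<Lambda>\<close> between \<open>\<Gamma>\<close> and its commensurator acts on the locally finite graph with
  vertex set \<open>\<Lambda>/\<Gamma>\<close>, and for a compact open subgroup \<open>U\<close> the subgroup \<open>\<Lambda> \<inter> U\<close> acts on it with finite
  stabilisers and, because \<open>U\G/\<Gamma>\<close> is finite, with finitely many orbits; hence \<open>\<Lambda> \<inter> U\<close> is finitely
  generated (\<open>finitely_generated_Int_compact_open\<close>). Closed subgroups containing the discrete residual
  are assumed not to be locally finitely generated, so \<open>J\<close> does not contain it, and neither does the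
  smaller group \<open>M\<close>. The alternative for closed normal subgroups then yields a compact subgroup \<open>K\<close>
  of \<open>M\<close> that is open in \<open>M\<close> and normal in \<open>G\<close>.

  This information about the intersection \<open>M\<close> passes to a single approximant by compactness. Choose a
  compact open subgroup \<open>W\<close> with \<open>W \<inter> M = K\<close>. The set of those elements that leave \<open>W\<close> when \<open>W\<close> is
  conjugated by the finitely many generators of \<open>\<Gamma>\<close> is compact and disjoint from \<open>M\<close>, so it is disjoint
  from some approximant \<open>L\<close>, and after intersecting the finitely many \<open>\<Gamma>\<close>-conjugates of \<open>L\<close> the
  compact group \<open>L \<inter> W\<close> is normalised by \<open>\<Gamma>\<close> (\<open>lattice_invariant_approximant\<close>).

  A compact subgroup \<open>P\<close> normalised by \<open>\<Gamma>\<close> has orbits of bounded size on \<open>G/U\<close>, as there are only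
  finitely many \<open>\<Gamma>\<close>-orbits there. If \<open>U\<close> has trivial normal core this action is faithful, and since a
  finitely generated group has only finitely many subgroups of bounded index, finitely generated
  subgroups of \<open>P\<close> are finite (\<open>finite_of_finitely_generated_in_lattice_invariant_compact\<close>). This
  applies to \<open>\<Lambda> \<inter> W\<close>, where \<open>\<Lambda>\<close> is generated by the finite index subgroups \<open>\<Gamma> \<inter> L\<close> of \<open>\<Gamma>\<close> and
  \<open>H \<inter> L\<close> of \<open>H\<close>: by the argument used
  for \<open>J\<close> it is finitely generated, and it is contained in \<open>L \<inter> W\<close>, hence finite. As \<open>\<Lambda>\<close> consists of
  finitely many double cosets of \<open>\<Lambda> \<inter> W\<close> and \<open>\<Gamma> \<inter> L\<close>, the index of \<open>\<Gamma> \<inter> L\<close> in \<open>\<Lambda>\<close> is finite, and so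
  \<open>H\<close> is virtually contained in \<open>\<Gamma>\<close>.
\<close>

section \<open>Conjugates and virtual containment\<close>

lemma finite_image_coarser:
  assumes "finite (f ` A)" and "\<And>x y. x \<in> A \<Longrightarrow> y \<in> A \<Longrightarrow> f x = f y \<Longrightarrow> g x = g y"
  shows "finite (g ` A)"
proof (rule finite_subset)
  show "finite ((\<lambda>z. g (inv_into A f z)) ` f ` A)"
    using assms(1) by (rule finite_imageI)
  show "g ` A \<subseteq> (\<lambda>z. g (inv_into A f z)) ` f ` A"
  proof
    fix w assume "w \<in> g ` A"
    then obtain x where x: "x \<in> A" "w = g x" by blast
    have fx: "f x \<in> f ` A" using x(1) by blast
    have "g (inv_into A f (f x)) = g x"
      by (rule assms(2)[OF inv_into_into[OF fx] x(1) f_inv_into_f[OF fx]])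
    then show "w \<in> (\<lambda>z. g (inv_into A f z)) ` f ` A"
      using x fx by (auto intro: image_eqI[where x = "f x"])
  qed
qed

context group
begin

lemma mult_inv_cancel_left:
  "g \<in> carrier G \<Longrightarrow> x \<in> carrier G \<Longrightarrow> g \<otimes> (inv g \<otimes> x) = x"
  "g \<in> carrier G \<Longrightarrow> x \<in> carrier G \<Longrightarrow> inv g \<otimes> (g \<otimes> x) = x"
  by (simp_all add: m_assoc[symmetric])

lemma r_coset_eq_iff:
  assumes "subgroup B G" "x \<in> carrier G" "y \<in> carrier G"
  shows "B #> x = B #> y \<longleftrightarrow> x \<otimes> inv y \<in> B"
proof
  assume "B #> x = B #> y"
  then have "x \<in> B #> y" using rcos_self[OF assms(2,1)] by simp
  then show "x \<otimes> inv y \<in> B"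
    using subgroup.rcos_module_imp[OF assms(1) is_group assms(3)] by simp
next
  assume "x \<otimes> inv y \<in> B"
  then have "x \<in> B #> y"
    using subgroup.rcos_module_rev[OF assms(1) is_group assms(3,2)] by simp
  then show "B #> x = B #> y"
    using repr_independence[OF _ assms(3,1)] by simp
qed

lemma conjugate_set_image: "conjugate_set G g A = (\<lambda>x. g \<otimes> x \<otimes> inv g) ` A"
  unfolding conjugate_set_def l_coset_def r_coset_def by auto

lemma conjugate_set_iff:
  assumes "A \<subseteq> carrier G" "g \<in> carrier G" "x \<in> carrier G"
  shows "x \<in> conjugate_set G g A \<longleftrightarrow> inv g \<otimes> x \<otimes> g \<in> A"
proof
  assume "x \<in> conjugate_set G g A"
  then obtain a where a: "a \<in> A" "x = g \<otimes> a \<otimes> inv g"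
    unfolding conjugate_set_image by blast
  then have "a \<in> carrier G" using assms by blast
  then have "inv g \<otimes> x \<otimes> g = a" using a assms by (simp add: m_assoc mult_inv_cancel_left)
  then show "inv g \<otimes> x \<otimes> g \<in> A" using a by simp
next
  assume *: "inv g \<otimes> x \<otimes> g \<in> A"
  have "x = g \<otimes> (inv g \<otimes> x \<otimes> g) \<otimes> inv g"
    using assms by (simp add: m_assoc mult_inv_cancel_left)
  then show "x \<in> conjugate_set G g A" unfolding conjugate_set_image using * by blast
qed

lemma conjugate_set_subset_carrier:
  "A \<subseteq> carrier G \<Longrightarrow> g \<in> carrier G \<Longrightarrow> conjugate_set G g A \<subseteq> carrier G"
  unfolding conjugate_set_image by auto

lemma conjugate_set_mono: "A \<subseteq> B \<Longrightarrow> conjugate_set G g A \<subseteq> conjugate_set G g B"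
  unfolding conjugate_set_image by auto

lemma conjugate_set_conjugate_set:
  assumes "A \<subseteq> carrier G" "g \<in> carrier G" "h \<in> carrier G"
  shows "conjugate_set G g (conjugate_set G h A) = conjugate_set G (g \<otimes> h) A"
proof -
  have "g \<otimes> (h \<otimes> x \<otimes> inv h) \<otimes> inv g = g \<otimes> h \<otimes> x \<otimes> inv (g \<otimes> h)" if "x \<in> A" for x
    using that assms by (subgoal_tac "x \<in> carrier G") (auto simp: m_assoc inv_mult_group)
  then show ?thesis unfolding conjugate_set_image image_image by (rule image_cong[OF refl])
qed

lemma conjugate_set_one: "A \<subseteq> carrier G \<Longrightarrow> conjugate_set G \<one> A = A"
proof -
  assume "A \<subseteq> carrier G"
  then have "\<one> \<otimes> x \<otimes> inv \<one> = x" if "x \<in> A" for x using that by auto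
  then show ?thesis unfolding conjugate_set_image by simp
qed

lemma conjugate_set_subset_subgroup:
  assumes "subgroup A G" "a \<in> A"
  shows "conjugate_set G a A \<subseteq> A"
  using assms subgroup.m_closed[OF assms(1)] subgroup.m_inv_closed[OF assms(1)]
  unfolding conjugate_set_image by auto

lemma conjugate_set_subgroup_self:
  assumes "subgroup A G" "a \<in> A"
  shows "conjugate_set G a A = A"
proof
  interpret A: subgroup A G by fact
  show "conjugate_set G a A \<subseteq> A" by (rule conjugate_set_subset_subgroup[OF assms])
  have "conjugate_set G a (conjugate_set G (inv a) A) \<subseteq> conjugate_set G a A"
    using conjugate_set_subset_subgroup[OF assms(1), of "inv a"] assms(2) by (intro conjugate_set_mono) simp
  then show "A \<subseteq> conjugate_set G a A"
    using assms(2) A.subset by (simp add: conjugate_set_conjugate_set conjugate_set_one)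
qed

lemma conjugate_set_r_coset:
  assumes "B \<subseteq> carrier G" "p \<in> carrier G" "g \<in> carrier G"
  shows "conjugate_set G g (B #> p) = conjugate_set G g B #> (g \<otimes> p \<otimes> inv g)"
proof -
  have "g \<otimes> (b \<otimes> p) \<otimes> inv g = (g \<otimes> b \<otimes> inv g) \<otimes> (g \<otimes> p \<otimes> inv g)" if "b \<in> B" for b
    using that assms by (subgoal_tac "b \<in> carrier G") (auto simp: m_assoc mult_inv_cancel_left)
  then show ?thesis unfolding conjugate_set_image r_coset_def by (auto simp: image_iff) 
qed

lemma subgroup_conjugate_set:
  assumes "subgroup A G" "g \<in> carrier G"
  shows "subgroup (conjugate_set G g A) G"
proof -
  interpret A: subgroup A G by fact
  show ?thesis
  proof
    show "conjugate_set G g A \<subseteq> carrier G"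
      by (rule conjugate_set_subset_carrier[OF A.subset assms(2)])
    show "\<one> \<in> conjugate_set G g A"
      using conjugate_set_iff[OF A.subset assms(2), of \<one>] assms(2) by simp
  next
    fix x y assume "x \<in> conjugate_set G g A" "y \<in> conjugate_set G g A"
    then obtain a b where ab: "a \<in> A" "b \<in> A" "x = g \<otimes> a \<otimes> inv g" "y = g \<otimes> b \<otimes> inv g"
      unfolding conjugate_set_image by blast
    then have "x \<otimes> y = g \<otimes> (a \<otimes> b) \<otimes> inv g"
      using assms(2) by (simp add: m_assoc mult_inv_cancel_left)
    then show "x \<otimes> y \<in> conjugate_set G g A" unfolding conjugate_set_image using ab by blast
  next
    fix x assume "x \<in> conjugate_set G g A"
    then obtain a where a: "a \<in> A" "x = g \<otimes> a \<otimes> inv g"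
      unfolding conjugate_set_image by blast
    then have "inv x = g \<otimes> inv a \<otimes> inv g"
      using assms(2) by (simp add: m_assoc inv_mult_group)
    then show "inv x \<in> conjugate_set G g A" unfolding conjugate_set_image using a by blast
  qed
qed

text \<open>
  For subgroups this says that \<open>A \<inter> B\<close> has finite index in \<open>A\<close>. Counting cosets of \<open>B\<close> itself, instead of
  \<open>A \<inter> B\<close>, makes the relation transitive and monotone without any containment between \<open>A\<close> and \<open>B\<close>.
\<close>

definition virtually_in :: "'a set \<Rightarrow> 'a set \<Rightarrow> bool" where
  "virtually_in A B \<longleftrightarrow> finite ((\<lambda>a. B #> a) ` A)"

lemma virtually_inI:
  assumes "subgroup B G" "A \<subseteq> carrier G" "finite (f ` A)"
    and "\<And>x y. x \<in> A \<Longrightarrow> y \<in> A \<Longrightarrow> f x = f y \<Longrightarrow> x \<otimes> inv y \<in> B"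
  shows "virtually_in A B"
  unfolding virtually_in_def
proof (rule finite_image_coarser[OF assms(3)])
  fix x y assume "x \<in> A" "y \<in> A" "f x = f y"
  then show "B #> x = B #> y"
    using r_coset_eq_iff[OF assms(1)] assms(2,4) by blast
qed

lemma virtually_in_subset: "virtually_in A B \<Longrightarrow> A' \<subseteq> A \<Longrightarrow> virtually_in A' B"
  unfolding virtually_in_def by (meson finite_subset image_mono)

lemma virtually_in_superset:
  assumes "virtually_in A B" "subgroup B G" "subgroup B' G" "A \<subseteq> carrier G" "B \<subseteq> B'"
  shows "virtually_in A B'"
proof (rule virtually_inI[OF assms(3,4) assms(1)[unfolded virtually_in_def]])
  fix x y assume "x \<in> A" "y \<in> A" "B #> x = B #> y"
  then have "x \<otimes> inv y \<in> B" using r_coset_eq_iff[OF assms(2)] assms(4) by blast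
  then show "x \<otimes> inv y \<in> B'" using assms(5) by blast
qed

lemma virtually_in_refl: "subgroup A G \<Longrightarrow> virtually_in A A"
  by (rule virtually_inI[where f = "\<lambda>_. ()"])
    (auto simp: subgroup.subset subgroup.m_closed subgroup.m_inv_closed)

lemma virtually_in_Int:
  assumes "virtually_in A B" "virtually_in A B'" "subgroup B G" "subgroup B' G" "A \<subseteq> carrier G"
  shows "virtually_in A (B \<inter> B')"
proof (rule virtually_inI[where f = "\<lambda>a. (B #> a, B' #> a)"])
  show "subgroup (B \<inter> B') G" by (rule subgroups_Inter_pair[OF assms(3,4)])
  have "(\<lambda>a. (B #> a, B' #> a)) ` A \<subseteq> (\<lambda>a. B #> a) ` A \<times> (\<lambda>a. B' #> a) ` A" by blast
  then show "finite ((\<lambda>a. (B #> a, B' #> a)) ` A)"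
    using assms(1,2) unfolding virtually_in_def by (meson finite_SigmaI finite_subset)
next
  fix x y assume "x \<in> A" "y \<in> A" "(B #> x, B' #> x) = (B #> y, B' #> y)"
  then show "x \<otimes> inv y \<in> B \<inter> B'"
    using r_coset_eq_iff[OF assms(3)] r_coset_eq_iff[OF assms(4)] assms(5) by blast
qed (rule assms(5))

lemma virtually_in_representatives:
  assumes "virtually_in A B" "subgroup B G" "A \<subseteq> carrier G"
  obtains F where "finite F" "F \<subseteq> A" "\<And>a. a \<in> A \<Longrightarrow> \<exists>f\<in>F. a \<otimes> inv f \<in> B"
proof -
  from assms(1)[unfolded virtually_in_def]
  obtain F where F: "F \<subseteq> A" "finite F" "(\<lambda>a. B #> a) ` A = (\<lambda>a. B #> a) ` F"
    using finite_subset_image[of "(\<lambda>a. B #> a) ` A" "\<lambda>a. B #> a" A] by auto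
  have "\<exists>f\<in>F. a \<otimes> inv f \<in> B" if "a \<in> A" for a
  proof -
    have "B #> a \<in> (\<lambda>a. B #> a) ` F" using that F(3) by blast
    then obtain f where "f \<in> F" "B #> a = B #> f" by blast
    then show ?thesis using r_coset_eq_iff[OF assms(2)] that F(1) assms(3) by blast
  qed
  then show thesis using that F by blast
qed

lemma virtually_inI_representatives:
  assumes "subgroup B G" "A \<subseteq> carrier G" "finite F" "F \<subseteq> carrier G"
    and "\<And>a. a \<in> A \<Longrightarrow> \<exists>f\<in>F. a \<otimes> inv f \<in> B"
  shows "virtually_in A B"
  unfolding virtually_in_def
proof (rule finite_subset)
  show "finite ((\<lambda>f. B #> f) ` F)" using assms(3) by blast
  show "(\<lambda>a. B #> a) ` A \<subseteq> (\<lambda>f. B #> f) ` F"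
  proof
    fix w assume "w \<in> (\<lambda>a. B #> a) ` A"
    then obtain a where a: "a \<in> A" "w = B #> a" by blast
    then obtain f where "f \<in> F" "a \<otimes> inv f \<in> B" using assms(5) by blast
    then show "w \<in> (\<lambda>f. B #> f) ` F"
      using a r_coset_eq_iff[OF assms(1), of a f] assms(2,4) by blast
  qed
qed

lemma virtually_in_trans:
  assumes "virtually_in A B" "virtually_in B D" "subgroup A G" "subgroup B G" "subgroup D G"
  shows "virtually_in A D"
proof -
  interpret B: subgroup B G by fact
  interpret D: subgroup D G by fact
  note Ac = subgroup.subset[OF assms(3)]
  from virtually_in_representatives[OF assms(1,4) Ac]
  obtain F where F: "finite F" "F \<subseteq> A" "\<And>a. a \<in> A \<Longrightarrow> \<exists>f\<in>F. a \<otimes> inv f \<in> B" by blast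
  from virtually_in_representatives[OF assms(2,5) B.subset]
  obtain E where E: "finite E" "E \<subseteq> B" "\<And>b. b \<in> B \<Longrightarrow> \<exists>e\<in>E. b \<otimes> inv e \<in> D" by blast
  show ?thesis
  proof (rule virtually_inI_representatives[OF assms(5) Ac])
    show "finite ((\<lambda>(e, f). e \<otimes> f) ` (E \<times> F))" using E(1) F(1) by blast
    show "(\<lambda>(e, f). e \<otimes> f) ` (E \<times> F) \<subseteq> carrier G"
      using subsetD[OF E(2)] subsetD[OF F(2)] subsetD[OF Ac] subsetD[OF B.subset] by auto
    fix a assume a: "a \<in> A"
    obtain f where f: "f \<in> F" "a \<otimes> inv f \<in> B" using F(3)[OF a] by blast
    obtain e where e: "e \<in> E" "a \<otimes> inv f \<otimes> inv e \<in> D" using E(3)[OF f(2)] by blast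
    have "a \<in> carrier G" "f \<in> carrier G" "e \<in> carrier G"
      using a f e Ac F(2) E(2) B.subset by auto
    then have "a \<otimes> inv (e \<otimes> f) = a \<otimes> inv f \<otimes> inv e" by (simp add: inv_mult_group m_assoc)
    then show "\<exists>x\<in>(\<lambda>(e, f). e \<otimes> f) ` (E \<times> F). a \<otimes> inv x \<in> D"
      using e f by (intro bexI[of _ "e \<otimes> f"]) auto
  qed
qed

lemma virtually_in_conjugate:
  assumes "virtually_in A B" "subgroup A G" "subgroup B G" "g \<in> carrier G"
  shows "virtually_in (conjugate_set G g A) (conjugate_set G g B)"
proof -
  note Ac = subgroup.subset[OF assms(2)] and Bc = subgroup.subset[OF assms(3)]
  from virtually_in_representatives[OF assms(1,3) Ac]
  obtain F where F: "finite F" "F \<subseteq> A" "\<And>a. a \<in> A \<Longrightarrow> \<exists>f\<in>F. a \<otimes> inv f \<in> B" by blast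
  show ?thesis
  proof (rule virtually_inI_representatives)
    show "subgroup (conjugate_set G g B) G" using assms by (rule_tac subgroup_conjugate_set)
    show "conjugate_set G g A \<subseteq> carrier G" by (rule conjugate_set_subset_carrier[OF Ac assms(4)])
    show "finite (conjugate_set G g F)" unfolding conjugate_set_image using F(1) by blast
    show "conjugate_set G g F \<subseteq> carrier G"
      using conjugate_set_subset_carrier[of F g] F(2) Ac assms(4) by blast
    fix a assume "a \<in> conjugate_set G g A"
    then obtain x where x: "x \<in> A" "a = g \<otimes> x \<otimes> inv g" unfolding conjugate_set_image by blast
    obtain f where f: "f \<in> F" "x \<otimes> inv f \<in> B" using F(3)[OF x(1)] by blast
    have c: "x \<in> carrier G" "f \<in> carrier G" using x f F Ac by auto
    have "a \<otimes> inv (g \<otimes> f \<otimes> inv g) = g \<otimes> (x \<otimes> inv f) \<otimes> inv g"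
      using x(2) c assms(4) by (simp add: m_assoc inv_mult_group mult_inv_cancel_left)
    then show "\<exists>f\<in>conjugate_set G g F. a \<otimes> inv f \<in> conjugate_set G g B"
      using f unfolding conjugate_set_image by auto
  qed
qed

lemma finite_index_subgroup_iff:
  assumes "subgroup A G" "subgroup B G" "B \<subseteq> A"
  shows "finite_index_subgroup B (G\<lparr>carrier := A\<rparr>) \<longleftrightarrow> virtually_in A B"
proof -
  have "subgroup B (G\<lparr>carrier := A\<rparr>)"
    using subgroup_incl[OF assms(2,1,3)] .
  moreover have "rcosets\<^bsub>G\<lparr>carrier := A\<rparr>\<^esub> B = (\<lambda>a. B #> a) ` A"
    unfolding RCOSETS_def by auto
  ultimately show ?thesis unfolding finite_index_subgroup_def virtually_in_def by simp
qed

lemma commensurable_imp_virtually_in: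
  assumes "subgroup A G" "subgroup B G" "commensurable G A B"
  shows "virtually_in A B"
proof -
  have I: "subgroup (A \<inter> B) G" by (rule subgroups_Inter_pair[OF assms(1,2)])
  have "virtually_in A (A \<inter> B)"
    using assms(3) finite_index_subgroup_iff[OF assms(1) I] unfolding commensurable_def by auto
  then show ?thesis
    using virtually_in_superset[OF _ I assms(2) subgroup.subset[OF assms(1)]] by blast
qed

lemma finitely_generated_group_iff:
  assumes "subgroup A G"
  shows "finitely_generated_group (G\<lparr>carrier := A\<rparr>) \<longleftrightarrow>
    (\<exists>S. finite S \<and> S \<subseteq> A \<and> generate G S = A)"
  unfolding finitely_generated_group_def using generate_consistent[OF _ assms] by auto

lemma virtually_in_Inter:
  assumes "finite \<D>" "\<D> \<noteq> {}" "A \<subseteq> carrier G"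
    and "\<And>D. D \<in> \<D> \<Longrightarrow> subgroup D G" "\<And>D. D \<in> \<D> \<Longrightarrow> virtually_in A D"
  shows "virtually_in A (\<Inter>\<D>)"
proof (rule virtually_inI[where f = "\<lambda>a. \<lambda>D\<in>\<D>. D #> a"])
  show "subgroup (\<Inter>\<D>) G" using subgroups_Inter assms(2,4) by blast
  have "(\<lambda>a. \<lambda>D\<in>\<D>. D #> a) ` A \<subseteq> (\<Pi>\<^sub>E D\<in>\<D>. (\<lambda>a. D #> a) ` A)" by auto
  moreover have "finite (\<Pi>\<^sub>E D\<in>\<D>. (\<lambda>a. D #> a) ` A)"
    by (rule finite_PiE[OF assms(1)]) (use assms(5) virtually_in_def in blast)
  ultimately show "finite ((\<lambda>a. \<lambda>D\<in>\<D>. D #> a) ` A)" by (rule finite_subset)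
next
  fix x y assume xy: "x \<in> A" "y \<in> A" and eq: "(\<lambda>D\<in>\<D>. D #> x) = (\<lambda>D\<in>\<D>. D #> y)"
  have "x \<otimes> inv y \<in> D" if D: "D \<in> \<D>" for D
    using fun_cong[OF eq, of D] r_coset_eq_iff[OF assms(4)[OF D]] xy assms(3) D by auto
  then show "x \<otimes> inv y \<in> \<Inter>\<D>" by blast
qed (rule assms(3))

lemma finite_if_virtually_in_finite:
  assumes "virtually_in A B" "subgroup A G" "subgroup B G" "finite B"
  shows "finite A"
proof -
  note Ac = subgroup.subset[OF assms(2)]
  obtain F where F: "finite F" "F \<subseteq> A" "\<And>a. a \<in> A \<Longrightarrow> \<exists>f\<in>F. a \<otimes> inv f \<in> B"
    using virtually_in_representatives[OF assms(1,3) Ac] by blast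
  have "A \<subseteq> (\<lambda>(b, f). b \<otimes> f) ` (B \<times> F)"
  proof
    fix a assume a: "a \<in> A"
    obtain f where f: "f \<in> F" "a \<otimes> inv f \<in> B" using F(3)[OF a] by blast
    then have "a = a \<otimes> inv f \<otimes> f"
      using a F(2) Ac subsetD by (simp add: m_assoc subset_iff)
    then show "a \<in> (\<lambda>(b, f). b \<otimes> f) ` (B \<times> F)" using f by force
  qed
  then show ?thesis by (rule finite_subset) (use F(1) assms(4) in blast)
qed

text \<open>
  Induction along a word in the generators. Right translates are used because the cosets \<open>B #> x\<close> are
  permuted by right multiplication.
\<close>

lemma generate_right_translates:
  assumes "T \<subseteq> carrier G" "h \<in> generate G T"
    and "\<And>x t. x \<in> carrier G \<Longrightarrow> t \<in> T \<Longrightarrow> P x \<Longrightarrow> P (x \<otimes> t)"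
    and "\<And>x t. x \<in> carrier G \<Longrightarrow> t \<in> T \<Longrightarrow> P x \<Longrightarrow> P (x \<otimes> inv t)"
  shows "x \<in> carrier G \<Longrightarrow> P x \<Longrightarrow> P (x \<otimes> h)"
  using assms(2)
proof (induction h arbitrary: x rule: generate.induct)
  case one
  then show ?case by simp
next
  case (eng h1 h2)
  have c: "h1 \<in> carrier G" "h2 \<in> carrier G"
    using eng.hyps generate_in_carrier[OF assms(1)] by blast+
  have "P (x \<otimes> h1)" by (rule eng.IH(1)[OF eng.prems])
  then show ?case using eng.IH(2)[of "x \<otimes> h1"] c eng.prems(1) by (simp add: m_assoc)
qed (use assms(3,4) in blast)+

section \<open>Finite generation and subgroups of bounded index\<close>

text \<open>
  The algebraic form of the Milnor--Schwarz lemma for the action of \<open>A\<close> on \<open>\<Lambda>/\<Gamma>\<close>. Joining \<open>x\<Gamma>\<close> to the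
  cosets contained in \<open>x\<Gamma>t\<Gamma>\<close>, for the generators \<open>t\<close> of \<open>\<Lambda>\<close>, gives a connected graph, which is
  locally finite because \<open>\<Gamma>\<close> is commensurated. The group \<open>A\<close> acts on it with finitely many orbits and
  finite stabilisers, so it is generated by the elements that move a finite set of orbit
  representatives to itself or to a neighbour of it.
\<close>

lemma finitely_generated_of_double_cosets:
  assumes A: "subgroup A G" "A \<subseteq> \<Lambda>" and \<Gamma>: "subgroup \<Gamma> G" "\<Gamma> \<subseteq> \<Lambda>"
    and \<Lambda>: "finite T" "T \<subseteq> carrier G" "generate G T = \<Lambda>"
    and fin: "finite (A \<inter> \<Gamma>)"
    and comm: "\<And>t. t \<in> \<Lambda> \<Longrightarrow> virtually_in \<Gamma> (conjugate_set G t \<Gamma>)"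
    and F0: "finite F0" "F0 \<subseteq> \<Lambda>"
    and cover0: "\<And>x. x \<in> \<Lambda> \<Longrightarrow> \<exists>a\<in>A. \<exists>f\<in>F0. \<exists>g\<in>\<Gamma>. x = a \<otimes> f \<otimes> g"
  shows "\<exists>S. finite S \<and> S \<subseteq> A \<and> generate G S = A"
proof -
  interpret A: subgroup A G by fact
  interpret \<Gamma>: subgroup \<Gamma> G by fact
  have sg\<Lambda>: "subgroup \<Lambda> G" using generate_is_subgroup[OF \<Lambda>(2)] \<Lambda>(3) by simp
  interpret \<Lambda>: subgroup \<Lambda> G by fact
  define T' where "T' = T \<union> (\<lambda>t. inv t) ` T"
  define F where "F = insert \<one> F0"
  have T\<Lambda>: "T \<subseteq> \<Lambda>" using \<Lambda>(3) generate.incl[of _ T G] by blast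
  then have T': "finite T'" "T' \<subseteq> \<Lambda>" unfolding T'_def using \<Lambda>(1) by auto
  have F: "finite F" "F \<subseteq> \<Lambda>" "\<one> \<in> F" unfolding F_def using F0 by auto
  have "\<exists>p. fst p \<in> A \<and> fst (snd p) \<in> F \<and> snd (snd p) \<in> \<Gamma> \<and> x = fst p \<otimes> fst (snd p) \<otimes> snd (snd p)"
    if "x \<in> \<Lambda>" for x using cover0[OF that] unfolding F_def by force
  then obtain p where p: "\<And>x. x \<in> \<Lambda> \<Longrightarrow> fst (p x) \<in> A \<and> fst (snd (p x)) \<in> F \<and> snd (snd (p x)) \<in> \<Gamma>
      \<and> x = fst (p x) \<otimes> fst (snd (p x)) \<otimes> snd (snd (p x))" by metis
  have "\<exists>E. finite E \<and> E \<subseteq> \<Gamma> \<and> (\<forall>g\<in>\<Gamma>. \<exists>e\<in>E. g \<otimes> inv e \<in> conjugate_set G t \<Gamma>)" if "t \<in> T'" for t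
    using virtually_in_representatives[OF comm subgroup_conjugate_set[OF \<Gamma>(1)] \<Gamma>.subset] that T'(2)
    by (metis \<Lambda>.mem_carrier subsetD)
  then obtain E where E: "\<And>t. t \<in> T' \<Longrightarrow> finite (E t)" "\<And>t. t \<in> T' \<Longrightarrow> E t \<subseteq> \<Gamma>"
      "\<And>t g. t \<in> T' \<Longrightarrow> g \<in> \<Gamma> \<Longrightarrow> \<exists>e\<in>E t. g \<otimes> inv e \<in> conjugate_set G t \<Gamma>" by metis
  \<comment> \<open>The elements of \<open>A\<close> that occur when a neighbour of a representative is moved back to a representative.\<close>
  define B where "B = (\<Union>t\<in>T'. (\<lambda>(f, e). fst (p (f \<otimes> inv e \<otimes> t))) ` (F \<times> E t))"
  have B: "finite B" unfolding B_def using T'(1) F(1) E(1) by blast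
  have in\<Lambda>: "f \<otimes> inv e \<otimes> t \<in> \<Lambda>" if "t \<in> T'" "f \<in> F" "e \<in> E t" for t f e
    using that E(2)[OF that(1)] F(2) T'(2) \<Gamma>(2) by (meson \<Lambda>.m_closed \<Lambda>.m_inv_closed subsetD)
  have BA: "B \<subseteq> A" unfolding B_def using p in\<Lambda> by fastforce
  define X where "X = {b \<otimes> f \<otimes> g | b f g. b \<in> generate G B \<and> f \<in> F \<and> g \<in> \<Gamma>}"
  have sgB: "subgroup (generate G B) G" using generate_is_subgroup BA A.subset by blast
  have genBA: "generate G B \<subseteq> A" by (rule generate_subgroup_incl[OF BA A(1)])
  have Xt: "x \<otimes> t \<in> X" if "x \<in> X" "t \<in> T'" for x t
  proof -
    obtain b f g where x: "x = b \<otimes> f \<otimes> g" "b \<in> generate G B" "f \<in> F" "g \<in> \<Gamma>"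
      using \<open>x \<in> X\<close> unfolding X_def by blast
    have tc: "t \<in> carrier G" using \<open>t \<in> T'\<close> T'(2) \<Lambda>.subset by blast
    obtain e where e: "e \<in> E t" "inv g \<otimes> inv e \<in> conjugate_set G t \<Gamma>"
      using E(3)[OF \<open>t \<in> T'\<close> \<Gamma>.m_inv_closed[OF x(4)]] by blast
    then obtain d where d: "d \<in> \<Gamma>" "inv g \<otimes> inv e = t \<otimes> d \<otimes> inv t"
      unfolding conjugate_set_image by blast
    have ec: "e \<in> carrier G" using e E(2)[OF \<open>t \<in> T'\<close>] \<Gamma>.subset by blast
    have fc: "f \<in> carrier G" using x(3) F(2) \<Lambda>.subset by blast
    have bc: "b \<in> carrier G" using x(2) genBA A.subset by blast
    have "inv (inv g \<otimes> inv e) = inv (t \<otimes> d \<otimes> inv t)" using d(2) by simp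
    then have "e \<otimes> g = t \<otimes> inv d \<otimes> inv t"
      using ec x(4) d(1) tc by (simp add: inv_mult_group m_assoc)
    then have "inv e \<otimes> (e \<otimes> g) \<otimes> t = inv e \<otimes> (t \<otimes> inv d \<otimes> inv t) \<otimes> t" by simp
    then have gt: "g \<otimes> t = inv e \<otimes> t \<otimes> inv d"
      using ec x(4) d(1) tc by (simp add: m_assoc mult_inv_cancel_left)
    define y where "y = f \<otimes> inv e \<otimes> t"
    have y: "y \<in> \<Lambda>" unfolding y_def using in\<Lambda> that x(3) e(1) by blast
    obtain a f' g' where a: "a \<in> B" "f' \<in> F" "g' \<in> \<Gamma>" "y = a \<otimes> f' \<otimes> g'"
    proof -
      have "fst (p y) \<in> B" unfolding B_def y_def using \<open>t \<in> T'\<close> x(3) e(1) by force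
      then show thesis using that p[OF y] by blast
    qed
    have ac: "a \<in> carrier G" "f' \<in> carrier G" using a BA F(2) A.subset \<Lambda>.subset by blast+
    have "x \<otimes> t = b \<otimes> (f \<otimes> (g \<otimes> t))" using x(1,4) bc fc tc by (simp add: m_assoc)
    also have "\<dots> = b \<otimes> y \<otimes> inv d"
      unfolding gt y_def using bc fc tc ec d(1) by (simp add: m_assoc)
    also have "\<dots> = (b \<otimes> a) \<otimes> f' \<otimes> (g' \<otimes> inv d)"
      unfolding a(4) using bc ac a(3) d(1) by (simp add: m_assoc)
    finally show ?thesis
      unfolding X_def using a d(1) x(2) subgroup.m_closed[OF sgB x(2) generate.incl[OF a(1)]] by blast
  qed
  have "\<one> \<otimes> \<one> \<otimes> \<one> \<in> X"
    unfolding X_def using F(3) generate.one[of G B] \<Gamma>.one_closed by blast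
  then have oneX: "\<one> \<in> X" by simp
  have \<Lambda>X: "\<Lambda> \<subseteq> X"
  proof
    fix h assume h: "h \<in> \<Lambda>"
    have "\<one> \<otimes> h \<in> X"
    proof (rule generate_right_translates[where P = "\<lambda>x. x \<in> X", OF \<Lambda>(2) h[folded \<Lambda>(3)]])
      show "x \<otimes> t \<in> X" if "t \<in> T" "x \<in> X" for x t using Xt that unfolding T'_def by blast
      show "x \<otimes> inv t \<in> X" if "t \<in> T" "x \<in> X" for x t using Xt that unfolding T'_def by blast
    qed (rule one_closed, rule oneX)
    then show "h \<in> X" using h by simp
  qed
  \<comment> \<open>The elements of \<open>A\<close> that move the base vertex to a representative.\<close>
  define Q where "Q = (\<Union>f\<in>F. {a \<in> A. inv f \<otimes> a \<in> \<Gamma>})"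
  have "finite {a \<in> A. inv f \<otimes> a \<in> \<Gamma>}" if "f \<in> F" for f
  proof (cases "{a \<in> A. inv f \<otimes> a \<in> \<Gamma>} = {}")
    case False
    then obtain a0 where a0: "a0 \<in> A" "inv f \<otimes> a0 \<in> \<Gamma>" by blast
    have "{a \<in> A. inv f \<otimes> a \<in> \<Gamma>} \<subseteq> (\<lambda>z. a0 \<otimes> z) ` (A \<inter> \<Gamma>)"
    proof
      fix a assume a: "a \<in> {a \<in> A. inv f \<otimes> a \<in> \<Gamma>}"
      have fc: "f \<in> carrier G" using that F(2) \<Lambda>.subset by blast
      have "inv (inv f \<otimes> a0) \<otimes> (inv f \<otimes> a) \<in> \<Gamma>" using a a0 by blast
      then have "inv a0 \<otimes> a \<in> \<Gamma>"
        using a a0 fc by (simp add: inv_mult_group m_assoc mult_inv_cancel_left)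
      moreover have "inv a0 \<otimes> a \<in> A" "a = a0 \<otimes> (inv a0 \<otimes> a)"
        using a a0 by (auto simp: mult_inv_cancel_left)
      ultimately show "a \<in> (\<lambda>z. a0 \<otimes> z) ` (A \<inter> \<Gamma>)" by blast
    qed
    then show ?thesis by (rule finite_subset) (use fin in blast)
  next
    case True
    then show ?thesis by (metis finite.emptyI)
  qed
  then have Q: "finite Q" unfolding Q_def using F(1) by blast
  have "A \<subseteq> generate G (B \<union> Q)"
  proof
    fix a assume a: "a \<in> A"
    then obtain b f g where x: "a = b \<otimes> f \<otimes> g" "b \<in> generate G B" "f \<in> F" "g \<in> \<Gamma>"
      using \<Lambda>X A(2) unfolding X_def by blast
    have c: "b \<in> A" "b \<in> carrier G" "f \<in> carrier G" using x genBA F(2) by auto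
    have inA: "inv b \<otimes> a \<in> A" using a c by blast
    have "inv b \<otimes> a = f \<otimes> g" unfolding x(1) using c x(4) by (simp add: m_assoc mult_inv_cancel_left)
    then have "inv f \<otimes> (inv b \<otimes> a) \<in> \<Gamma>" using c x(4) by (simp add: mult_inv_cancel_left)
    with inA have iQ: "inv b \<otimes> a \<in> Q" unfolding Q_def using x(3) by blast
    have "b \<in> generate G (B \<union> Q)" using x(2) mono_generate[of B "B \<union> Q"] by blast
    from generate.eng[OF this generate.incl, of "inv b \<otimes> a"] iQ
    have "b \<otimes> (inv b \<otimes> a) \<in> generate G (B \<union> Q)" by blast
    then show "a \<in> generate G (B \<union> Q)" using a c by (simp add: mult_inv_cancel_left)
  qed
  moreover have "B \<union> Q \<subseteq> A" unfolding Q_def using BA by blast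
  ultimately show ?thesis using B Q generate_subgroup_incl[OF _ A(1), of "B \<union> Q"] by blast
qed

text \<open>
  Schreier's lemma, as the case of the trivial subgroup \<open>\<Gamma>\<close>.
\<close>

corollary finitely_generated_finite_index:
  assumes A: "subgroup A G" "A \<subseteq> \<Lambda>" and \<Lambda>: "finite T" "T \<subseteq> carrier G" "generate G T = \<Lambda>"
    and v: "virtually_in \<Lambda> A"
  shows "\<exists>S. finite S \<and> S \<subseteq> A \<and> generate G S = A"
proof -
  have sg\<Lambda>: "subgroup \<Lambda> G" using generate_is_subgroup[OF \<Lambda>(2)] \<Lambda>(3) by simp
  interpret \<Lambda>: subgroup \<Lambda> G by fact
  obtain F where F: "finite F" "F \<subseteq> \<Lambda>" "\<And>a. a \<in> \<Lambda> \<Longrightarrow> \<exists>f\<in>F. a \<otimes> inv f \<in> A"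
    using virtually_in_representatives[OF v A(1) \<Lambda>.subset] by blast
  show ?thesis
  proof (rule finitely_generated_of_double_cosets[OF A, of "{\<one>}", OF _ _ \<Lambda> _ _ F(1,2)])
    show "subgroup {\<one>} G" by (rule triv_subgroup)
    show "{\<one>} \<subseteq> \<Lambda>" by simp
    show "finite (A \<inter> {\<one>})" by simp
    show "virtually_in {\<one>} (conjugate_set G t {\<one>})" if "t \<in> \<Lambda>" for t
      unfolding virtually_in_def by simp
    fix x assume x: "x \<in> \<Lambda>"
    then obtain f where f: "f \<in> F" "x \<otimes> inv f \<in> A" using F(3) by blast
    then have "x = x \<otimes> inv f \<otimes> f \<otimes> \<one>" using x F(2) by (auto simp: m_assoc subset_iff)
    then show "\<exists>a\<in>A. \<exists>f\<in>F. \<exists>g\<in>{\<one>}. x = a \<otimes> f \<otimes> g" using f by blast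
  qed
qed

text \<open>
  Numbering the cosets of \<open>B\<close> in \<open>A\<close> by \<open>0, ..., n - 1\<close> turns right multiplication into an action on
  numbers. It is determined by finitely many values, namely those of the generators, and \<open>A \<inter> B\<close> can be
  recovered from it as the stabiliser of the number of the trivial coset.
\<close>

lemma finitely_many_subgroups_of_bounded_index:
  assumes T: "finite T" "T \<subseteq> carrier G" and A: "generate G T = A"
    and \<B>: "\<And>B. B \<in> \<B> \<Longrightarrow> subgroup B G" "\<And>B. B \<in> \<B> \<Longrightarrow> virtually_in A B"
      "\<And>B. B \<in> \<B> \<Longrightarrow> card ((\<lambda>a. B #> a) ` A) \<le> n"
  shows "finite ((\<lambda>B. A \<inter> B) ` \<B>)"
proof -
  have sgA: "subgroup A G" using generate_is_subgroup[OF T(2)] A by simp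
  interpret A: subgroup A G by fact
  define T' where "T' = T \<union> (\<lambda>t. inv t) ` T"
  have "T \<subseteq> A" using A generate.incl[of _ T G] by blast
  then have T': "finite T'" "T' \<subseteq> A" unfolding T'_def using T(1) by auto
  have "\<exists>\<phi>. (\<forall>x\<in>A. \<phi> x < n) \<and> (\<forall>x\<in>A. \<forall>y\<in>A. \<phi> x = \<phi> y \<longleftrightarrow> x \<otimes> inv y \<in> B)" if B: "B \<in> \<B>" for B
  proof -
    have fin: "finite ((\<lambda>a. B #> a) ` A)" using \<B>(2)[OF B] unfolding virtually_in_def .
    obtain e where e: "bij_betw e ((\<lambda>a. B #> a) ` A) {0..<card ((\<lambda>a. B #> a) ` A)}"
      using ex_bij_betw_finite_nat[OF fin] by blast
    have "e (B #> x) < n" if "x \<in> A" for x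
      using bij_betwE[OF e] that \<B>(3)[OF B] by fastforce
    moreover have "e (B #> x) = e (B #> y) \<longleftrightarrow> x \<otimes> inv y \<in> B" if "x \<in> A" "y \<in> A" for x y
      using inj_on_eq_iff[OF bij_betw_imp_inj_on[OF e]] r_coset_eq_iff[OF \<B>(1)[OF B]] that by auto
    ultimately show ?thesis by (intro exI[of _ "\<lambda>x. e (B #> x)"]) blast
  qed
  then obtain \<phi> where \<phi>: "\<And>B x. B \<in> \<B> \<Longrightarrow> x \<in> A \<Longrightarrow> \<phi> B x < n"
      "\<And>B x y. B \<in> \<B> \<Longrightarrow> x \<in> A \<Longrightarrow> y \<in> A \<Longrightarrow> \<phi> B x = \<phi> B y \<longleftrightarrow> x \<otimes> inv y \<in> B"
    by metis
  \<comment> \<open>Where \<open>k\<close> is not the number of a coset, the value is arbitrary; it only has to lie below \<open>n\<close>.\<close>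
  define act where "act B = (\<lambda>(t, k)\<in>T' \<times> {..<n}.
      if \<exists>x\<in>A. \<phi> B x = k then \<phi> B ((SOME x. x \<in> A \<and> \<phi> B x = k) \<otimes> t) else k)" for B
  have act: "act B (t, \<phi> B x) = \<phi> B (x \<otimes> t)" if B: "B \<in> \<B>" and t: "t \<in> T'" and x: "x \<in> A" for B t x
  proof -
    define y where "y = (SOME y. y \<in> A \<and> \<phi> B y = \<phi> B x)"
    have y: "y \<in> A \<and> \<phi> B y = \<phi> B x" unfolding y_def by (rule someI[of _ x]) (use x in blast)
    have c: "x \<in> carrier G" "y \<in> carrier G" "t \<in> A" "t \<in> carrier G" using x y t T'(2) by auto
    have "y \<otimes> inv x \<in> B" using \<phi>(2)[OF B] y x by blast
    then have "(y \<otimes> t) \<otimes> inv (x \<otimes> t) \<in> B" using c by (simp add: m_assoc inv_mult_group mult_inv_cancel_left)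
    then have "\<phi> B (y \<otimes> t) = \<phi> B (x \<otimes> t)" using \<phi>(2)[OF B] x y c by blast
    then show ?thesis unfolding act_def using x t \<phi>(1)[OF B x] by (auto simp: y_def)
  qed
  have "finite ((\<lambda>B. (act B, \<phi> B \<one>)) ` \<B>)"
  proof (rule finite_subset)
    show "(\<lambda>B. (act B, \<phi> B \<one>)) ` \<B> \<subseteq> (T' \<times> {..<n} \<rightarrow>\<^sub>E {..<n}) \<times> {..<n}"
    proof (clarsimp, intro conjI)
      fix B assume B: "B \<in> \<B>"
      show "\<phi> B \<one> < n" by (rule \<phi>(1)[OF B A.one_closed])
      have "\<phi> B ((SOME x. x \<in> A \<and> \<phi> B x = k) \<otimes> t) < n" if "t \<in> T'" "\<exists>x\<in>A. \<phi> B x = k" for t k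
      proof -
        have "(SOME x. x \<in> A \<and> \<phi> B x = k) \<in> A" using someI_ex[of "\<lambda>x. x \<in> A \<and> \<phi> B x = k"] that by blast
        then show ?thesis using \<phi>(1)[OF B] that T'(2) by blast
      qed
      then show "act B \<in> T' \<times> {..<n} \<rightarrow>\<^sub>E {..<n}" unfolding act_def by (auto split: if_splits)
    qed
    show "finite ((T' \<times> {..<n} \<rightarrow>\<^sub>E {..<n}) \<times> {..<n})" using T'(1) by (intro finite_cartesian_product finite_PiE) auto
  qed
  then show ?thesis
  proof (rule finite_image_coarser)
    fix B B' assume B: "B \<in> \<B>" "B' \<in> \<B>" and eq: "(act B, \<phi> B \<one>) = (act B', \<phi> B' \<one>)"
    have step: "x \<otimes> t \<in> A \<and> \<phi> B (x \<otimes> t) = \<phi> B' (x \<otimes> t)"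
      if "t \<in> T'" "x \<in> A \<and> \<phi> B x = \<phi> B' x" for x t
      using act[OF B(1) that(1), of x] act[OF B(2) that(1), of x] eq that T'(2) by auto
    have "\<phi> B h = \<phi> B' h" if h: "h \<in> A" for h
    proof -
      have "\<one> \<otimes> h \<in> A \<and> \<phi> B (\<one> \<otimes> h) = \<phi> B' (\<one> \<otimes> h)"
      proof (rule generate_right_translates[OF T(2) h[folded A]])
        show "\<one> \<in> A \<and> \<phi> B \<one> = \<phi> B' \<one>" using eq by simp
      qed (rule one_closed step; simp add: T'_def)+
      then show ?thesis using h by simp
    qed
    then have "h \<in> B \<longleftrightarrow> h \<in> B'" if "h \<in> A" for h
      using \<phi>(2)[OF B(1) that A.one_closed] \<phi>(2)[OF B(2) that A.one_closed] that eq by auto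
    then show "A \<inter> B = A \<inter> B'" by blast
  qed
qed

corollary virtually_in_Inter_of_bounded_index:
  assumes T: "finite T" "T \<subseteq> carrier G" and A: "generate G T = A"
    and \<B>: "\<B> \<noteq> {}" "\<And>B. B \<in> \<B> \<Longrightarrow> subgroup B G" "\<And>B. B \<in> \<B> \<Longrightarrow> virtually_in A B"
      "\<And>B. B \<in> \<B> \<Longrightarrow> card ((\<lambda>a. B #> a) ` A) \<le> n"
  shows "virtually_in A (\<Inter>\<B>)"
proof -
  have sgA: "subgroup A G" using generate_is_subgroup[OF T(2)] A by simp
  have "virtually_in A (\<Inter>((\<lambda>B. A \<inter> B) ` \<B>))"
  proof (rule virtually_in_Inter)
    show "finite ((\<lambda>B. A \<inter> B) ` \<B>)"
      by (rule finitely_many_subgroups_of_bounded_index[OF T A \<B>(2-4)])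
  qed (use \<B> subgroup.subset[OF sgA] subgroups_Inter_pair[OF sgA]
        virtually_in_Int[OF virtually_in_refl[OF sgA] _ sgA] in auto)
  then show ?thesis
  proof (rule virtually_in_superset)
    show "subgroup (\<Inter>((\<lambda>B. A \<inter> B) ` \<B>)) G"
      by (rule subgroups_Inter) (use \<B> subgroups_Inter_pair[OF sgA] in auto)
    show "subgroup (\<Inter>\<B>) G" by (rule subgroups_Inter) (use \<B> in auto)
  qed (use subgroup.subset[OF sgA] in auto)
qed

end

section \<open>Topological groups\<close>

lemma compactin_Int_Inter_empty:
  assumes "compactin X K" "\<C> \<noteq> {}" "\<And>C. C \<in> \<C> \<Longrightarrow> closedin X C" "K \<inter> \<Inter>\<C> = {}"
  obtains \<F> where "finite \<F>" "\<F> \<noteq> {}" "\<F> \<subseteq> \<C>" "K \<inter> \<Inter>\<F> = {}"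
proof -
  let ?\<U> = "(\<lambda>C. topspace X - C) ` \<C>"
  have "\<forall>V\<in>?\<U>. openin X V" using assms(3) by blast
  moreover have "K \<subseteq> \<Union>?\<U>" using assms(4) compactin_subset_topspace[OF assms(1)] by blast
  ultimately obtain \<G> where \<G>: "finite \<G>" "\<G> \<subseteq> ?\<U>" "K \<subseteq> \<Union>\<G>"
    using assms(1) unfolding compactin_def by meson
  obtain \<F> where \<F>: "\<F> \<subseteq> \<C>" "finite \<F>" "\<G> = (\<lambda>C. topspace X - C) ` \<F>"
    using finite_subset_image[OF \<G>(1,2)] by blast
  obtain C where C: "C \<in> \<C>" using assms(2) by blast
  show thesis
  proof (rule that[of "insert C \<F>"])
    show "K \<inter> \<Inter>(insert C \<F>) = {}" using \<G>(3) \<F>(3) by blast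
  qed (use \<F> C in auto)
qed

context topological_group
begin

lemma continuous_map_left_mult: "g \<in> carrier G \<Longrightarrow> continuous_map T T (\<lambda>x. g \<otimes> x)"
  using continuous_map_compose[OF continuous_map_pairedI continuous_map_mult,
      of T "\<lambda>_. g" "\<lambda>x. x"]
  by (simp add: o_def topspace_eq_carrier)

lemma continuous_map_right_mult: "g \<in> carrier G \<Longrightarrow> continuous_map T T (\<lambda>x. x \<otimes> g)"
  using continuous_map_compose[OF continuous_map_pairedI continuous_map_mult,
      of T "\<lambda>x. x" "\<lambda>_. g"]
  by (simp add: o_def topspace_eq_carrier)

lemma continuous_map_conjugate_element:
  assumes "m \<in> carrier G"
  shows "continuous_map T T (\<lambda>g. g \<otimes> m \<otimes> inv g)"
  using continuous_map_compose[OF continuous_map_pairedI[OF continuous_map_right_mult[OF assms]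
        continuous_map_inv] continuous_map_mult]
  by (simp add: o_def)

lemma homeomorphic_map_right_mult:
  assumes "g \<in> carrier G"
  shows "homeomorphic_map T T (\<lambda>x. x \<otimes> g)"
  unfolding homeomorphic_map_maps
  by (intro exI[of _ "\<lambda>x. x \<otimes> inv g"])
    (use assms in \<open>simp add: homeomorphic_maps_def continuous_map_right_mult topspace_eq_carrier m_assoc\<close>)

lemma homeomorphic_map_conjugation:
  assumes "g \<in> carrier G"
  shows "homeomorphic_map T T (\<lambda>x. g \<otimes> x \<otimes> inv g)"
proof -
  have c: "continuous_map T T (\<lambda>x. h \<otimes> x \<otimes> inv h)" if "h \<in> carrier G" for h
    using continuous_map_compose[OF continuous_map_left_mult[OF that]
        continuous_map_right_mult[OF inv_closed[OF that]]] by (simp add: o_def)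
  show ?thesis
    unfolding homeomorphic_map_maps
    by (intro exI[of _ "\<lambda>x. inv g \<otimes> x \<otimes> inv (inv g)"])
      (use assms c[OF assms] c[OF inv_closed[OF assms]] in
        \<open>simp add: homeomorphic_maps_def topspace_eq_carrier m_assoc mult_inv_cancel_left\<close>)
qed

lemma openin_r_coset: "openin T U \<Longrightarrow> g \<in> carrier G \<Longrightarrow> openin T (U #> g)"
  using homeomorphic_map_openness[OF homeomorphic_map_right_mult, of g U] openin_subset[of T U]
  unfolding r_coset_def by (simp add: UNION_singleton_eq_range)

lemma openin_conjugate_set: "openin T U \<Longrightarrow> g \<in> carrier G \<Longrightarrow> openin T (conjugate_set G g U)"
  using homeomorphic_map_openness[OF homeomorphic_map_conjugation, of g U] openin_subset[of T U]
  unfolding conjugate_set_image by simp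

lemma closedin_conjugate_set:
  "closedin T U \<Longrightarrow> g \<in> carrier G \<Longrightarrow> closedin T (conjugate_set G g U)"
  using homeomorphic_map_closedness[OF homeomorphic_map_conjugation, of g U] closedin_subset[of T U]
  unfolding conjugate_set_image by simp

lemma compactin_conjugate_set:
  "compactin T U \<Longrightarrow> g \<in> carrier G \<Longrightarrow> compactin T (conjugate_set G g U)"
  using image_compactin[OF _ homeomorphic_imp_continuous_map[OF homeomorphic_map_conjugation], of U g]
  unfolding conjugate_set_image by simp

lemma compactin_imp_virtually_in_open:
  assumes "compactin T P" "openin T U" "subgroup U G"
  shows "virtually_in P U"
proof -
  have Pc: "P \<subseteq> carrier G" using compactin_subset_topspace[OF assms(1)] topspace_eq_carrier by simp
  have "\<forall>V\<in>(\<lambda>p. U #> p) ` P. openin T V" using openin_r_coset[OF assms(2)] Pc by blast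
  moreover have "P \<subseteq> \<Union>((\<lambda>p. U #> p) ` P)" using rcos_self[OF _ assms(3)] Pc by blast
  ultimately obtain \<F> where \<F>: "finite \<F>" "\<F> \<subseteq> (\<lambda>p. U #> p) ` P" "P \<subseteq> \<Union>\<F>"
    using assms(1) unfolding compactin_def by meson
  have "(\<lambda>p. U #> p) ` P \<subseteq> \<F>"
  proof
    fix X assume "X \<in> (\<lambda>p. U #> p) ` P"
    then obtain p where p: "p \<in> P" "X = U #> p" by blast
    then obtain Y where Y: "Y \<in> \<F>" "p \<in> Y" using \<F>(3) by blast
    then obtain q where q: "U #> q \<in> \<F>" "q \<in> P" "p \<in> U #> q" using \<F>(2) by auto
    have "q \<in> carrier G" using q(2) Pc by blast
    then have "U #> p = U #> q" using repr_independence[OF q(3) _ assms(3)] by simp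
    then show "X \<in> \<F>" using p q by simp
  qed
  then show ?thesis unfolding virtually_in_def using \<F>(1) by (rule finite_subset)
qed

lemma subgroup_closure_of:
  assumes "subgroup A G"
  shows "subgroup (T closure_of A) G"
proof -
  interpret A: subgroup A G by fact
  have At: "A \<subseteq> topspace T" using A.subset topspace_eq_carrier by simp
  show ?thesis
  proof
    show "T closure_of A \<subseteq> carrier G"
      using closure_of_subset_topspace[of T A] topspace_eq_carrier by simp
    show "\<one> \<in> T closure_of A" using closure_of_subset[OF At] A.one_closed by (rule subsetD)
  next
    fix x y assume xy: "x \<in> T closure_of A" "y \<in> T closure_of A"
    have "(\<lambda>(x, y). x \<otimes> y) ` (A \<times> A) \<subseteq> A" by auto
    then have "(\<lambda>(x, y). x \<otimes> y) ` (prod_topology T T closure_of (A \<times> A)) \<subseteq> T closure_of A"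
      using continuous_map_image_closure_subset[OF continuous_map_mult, of "A \<times> A"] closure_of_mono[of _ A T]
      by (meson order_trans)
    then show "x \<otimes> y \<in> T closure_of A" using xy by (force simp: closure_of_Times)
  next
    fix x assume x: "x \<in> T closure_of A"
    have "(\<lambda>x. inv x) ` A \<subseteq> A" by auto
    then have "(\<lambda>x. inv x) ` (T closure_of A) \<subseteq> T closure_of A"
      using continuous_map_image_closure_subset[OF continuous_map_inv, of A] closure_of_mono[of _ A T]
      by (meson order_trans)
    then show "inv x \<in> T closure_of A" using x by blast
  qed
qed

lemma topological_group_subgroup:
  assumes "subgroup A G"
  shows "topological_group (G\<lparr>carrier := A\<rparr>) (subtopology T A)"
proof -
  interpret A: subgroup A G by fact
  interpret GA: group "G\<lparr>carrier := A\<rparr>" by (rule subgroup_imp_group[OF assms])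
  have inv_eq: "inv\<^bsub>G\<lparr>carrier := A\<rparr>\<^esub> x = inv x" if "x \<in> A" for x
    by (rule m_inv_consistent[OF assms that])
  show ?thesis
  proof
    show top: "topspace (subtopology T A) = carrier (G\<lparr>carrier := A\<rparr>)"
      using A.subset topspace_eq_carrier by auto
    have "continuous_map (subtopology (prod_topology T T) (A \<times> A)) T (\<lambda>(x, y). x \<otimes> y)"
      by (rule continuous_map_from_subtopology[OF continuous_map_mult])
    then show "continuous_map (prod_topology (subtopology T A) (subtopology T A)) (subtopology T A)
        (\<lambda>(x, y). x \<otimes>\<^bsub>G\<lparr>carrier := A\<rparr>\<^esub> y)"
      by (auto simp: subtopology_Times[symmetric] continuous_map_in_subtopology Pi_iff)
    have "continuous_map (subtopology T A) (subtopology T A) (\<lambda>x. inv x)"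
      using continuous_map_from_subtopology[OF continuous_map_inv, of A]
      by (auto simp: continuous_map_in_subtopology Pi_iff)
    then show "continuous_map (subtopology T A) (subtopology T A) (\<lambda>x. inv\<^bsub>G\<lparr>carrier := A\<rparr>\<^esub> x)"
      by (rule continuous_map_eq) (simp add: inv_eq)
  qed
qed

end

lemma (in tdlc_group) profinite_group_compact_subgroup:
  assumes "subgroup A G" "compactin T A"
  shows "profinite_group (G\<lparr>carrier := A\<rparr>) (subtopology T A)"
proof -
  interpret A: topological_group "G\<lparr>carrier := A\<rparr>" "subtopology T A"
    by (rule topological_group_subgroup[OF assms(1)])
  show ?thesis
  proof
    show "Hausdorff_space (subtopology T A)" by (rule Hausdorff_space_subtopology[OF Hausdorff])
    show "compact_space (subtopology T A)" by (rule compact_space_subtopology[OF assms(2)])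
    show "totally_disconnected_space (subtopology T A)"
      using totally_disconnected unfolding totally_disconnected_space_def connectedin_subtopology
      by blast
  qed
qed

section \<open>Cocompact lattices in the presence of a core-free compact open subgroup\<close>

locale core_free_cocompact_lattice = tdlc_group +
  fixes U \<Gamma>
  assumes U: "subgroup U G" "compactin T U" "openin T U" "normal_core G U = {\<one>}"
    and lattice: "cocompact_lattice G T \<Gamma>"
begin

lemma subgroup_lattice: "subgroup \<Gamma> G"
  using lattice unfolding cocompact_lattice_def by blast

text \<open>
  The conjugates of \<open>U\<close> are closed and intersect trivially, so by compactness of \<open>U\<close> the intersection of
  finitely many of them is already contained in a given neighbourhood of the identity.
\<close>

lemma small_compact_open_subgroup:
  assumes "openin T V" "\<one> \<in> V"
  obtains W where "subgroup W G" "compactin T W" "openin T W" "W \<subseteq> V"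
proof -
  let ?\<C> = "(\<lambda>g. conjugate_set G g U) ` carrier G"
  have cpt: "compactin T (U - V)"
  proof -
    have "U - V = U \<inter> (topspace T - V)" using compactin_subset_topspace[OF U(2)] by blast
    then show ?thesis
      using compact_Int_closedin[OF U(2) closedin_diff[OF closedin_topspace assms(1)]] by simp
  qed
  have closed: "closedin T U" by (rule compactin_imp_closedin[OF Hausdorff U(2)])
  obtain \<F> where \<F>: "finite \<F>" "\<F> \<noteq> {}" "\<F> \<subseteq> ?\<C>" "(U - V) \<inter> \<Inter>\<F> = {}"
  proof (rule compactin_Int_Inter_empty[OF cpt])
    show "?\<C> \<noteq> {}" by blast
    show "closedin T C" if "C \<in> ?\<C>" for C using that closedin_conjugate_set[OF closed] by blast
    show "(U - V) \<inter> \<Inter>?\<C> = {}" using U(4) assms(2) unfolding normal_core_def by auto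
  qed
  have sub: "\<And>D. D \<in> insert U \<F> \<Longrightarrow> subgroup D G"
    using \<F>(3) subgroup_conjugate_set[OF U(1)] U(1) by blast
  have op: "\<And>D. D \<in> insert U \<F> \<Longrightarrow> openin T D"
    using \<F>(3) openin_conjugate_set[OF U(3)] U(3) by blast
  show thesis
  proof (rule that[of "\<Inter>(insert U \<F>)"])
    show "subgroup (\<Inter>(insert U \<F>)) G" using subgroups_Inter[of "insert U \<F>"] sub by blast
    show "openin T (\<Inter>(insert U \<F>))" by (rule openin_Inter) (use \<F>(1) op in auto)
    have "closedin T (\<Inter>(insert U \<F>))"
      by (rule closedin_Inter) (use \<F>(3) closed closedin_conjugate_set[OF closed] in auto)
    then show "compactin T (\<Inter>(insert U \<F>))" by (rule closed_compactin[OF U(2), rotated]) blast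
    show "\<Inter>(insert U \<F>) \<subseteq> V" using \<F>(4) by blast
  qed
qed

text \<open>
  A small open subgroup meets \<open>\<Gamma>\<close> trivially, so each of the finitely many cosets of it that cover \<open>P\<close>
  contains at most one element of \<open>\<Gamma>\<close>.
\<close>

lemma finite_lattice_Int_compact_subgroup:
  assumes "subgroup P G" "compactin T P"
  shows "finite (P \<inter> \<Gamma>)"
proof -
  interpret \<Gamma>: subgroup \<Gamma> G by (rule subgroup_lattice)
  have "openin (subtopology T \<Gamma>) {\<one>}"
    using lattice unfolding cocompact_lattice_def by simp
  then obtain V where V: "openin T V" "{\<one>} = V \<inter> \<Gamma>" unfolding openin_subtopology by blast
  then obtain W where W: "subgroup W G" "compactin T W" "openin T W" "W \<subseteq> V"
    using small_compact_open_subgroup[of V] by blast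
  have P\<Gamma>: "subgroup (P \<inter> \<Gamma>) G" by (rule subgroups_Inter_pair[OF assms(1) subgroup_lattice])
  note P\<Gamma>c = subgroup.subset[OF P\<Gamma>]
  have "virtually_in (P \<inter> \<Gamma>) W"
    using compactin_imp_virtually_in_open[OF assms(2) W(3,1)] by (rule virtually_in_subset) blast
  moreover have "virtually_in (P \<inter> \<Gamma>) \<Gamma>"
    using virtually_in_refl[OF subgroup_lattice] by (rule virtually_in_subset) blast
  ultimately have "virtually_in (P \<inter> \<Gamma>) (W \<inter> \<Gamma>)"
    by (rule virtually_in_Int[OF _ _ W(1) subgroup_lattice P\<Gamma>c])
  moreover have "W \<inter> \<Gamma> = {\<one>}" using V(2) W(4) subgroup.one_closed[OF W(1)] by blast
  ultimately show ?thesis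
    using finite_if_virtually_in_finite[OF _ P\<Gamma>, of "W \<inter> \<Gamma>"] triv_subgroup by simp
qed

text \<open>
  The sets \<open>Wf\<Gamma>\<close> are open and invariant under right multiplication by \<open>\<Gamma>\<close>, so their images form an
  open cover of the compact quotient by \<open>\<Gamma>\<close>.
\<close>

lemma finite_double_cosets_lattice:
  assumes "subgroup W G" "openin T W"
  obtains F where "finite F" "F \<subseteq> carrier G"
    "\<And>x. x \<in> carrier G \<Longrightarrow> \<exists>w\<in>W. \<exists>f\<in>F. \<exists>g\<in>\<Gamma>. x = w \<otimes> f \<otimes> g"
proof -
  interpret \<Gamma>: subgroup \<Gamma> G by (rule subgroup_lattice)
  interpret W: subgroup W G by fact
  let ?q = "\<lambda>g. g <# \<Gamma>" let ?Q = "quotient_topology T ?q"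
  have pre: "{x \<in> topspace T. ?q x \<in> ?q ` (W #> f)} = (\<Union>g\<in>\<Gamma>. W #> (f \<otimes> g))" (is "?L = ?R")
    if f: "f \<in> carrier G" for f
  proof
    show "?L \<subseteq> ?R"
    proof
      fix x assume "x \<in> ?L"
      then obtain w where w: "w \<in> W" "x \<in> carrier G" "?q x = ?q (w \<otimes> f)"
        unfolding r_coset_def topspace_eq_carrier by blast
      have "x \<in> ?q x" using w(2) unfolding l_coset_def by force
      then obtain g where "g \<in> \<Gamma>" "x = w \<otimes> f \<otimes> g" unfolding w(3) unfolding l_coset_def by blast
      then show "x \<in> ?R" using w f unfolding r_coset_def by (auto simp: m_assoc)
    qed
    show "?R \<subseteq> ?L"
    proof
      fix x assume "x \<in> ?R"
      then obtain g w where g: "g \<in> \<Gamma>" "w \<in> W" "x = w \<otimes> (f \<otimes> g)" unfolding r_coset_def by blast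
      then have x: "x = w \<otimes> f \<otimes> g" using f by (simp add: m_assoc)
      then have "x \<in> ?q (w \<otimes> f)" using g unfolding l_coset_def by blast
      then have "?q x = ?q (w \<otimes> f)"
        using l_repr_independence[OF _ _ subgroup_lattice] g f by (metis W.mem_carrier m_closed)
      then show "x \<in> ?L" using g x f unfolding r_coset_def topspace_eq_carrier by auto
    qed
  qed
  have op: "openin ?Q (?q ` (W #> f))" if f: "f \<in> carrier G" for f
    unfolding openin_quotient_topology pre[OF f]
  proof
    show "?q ` (W #> f) \<subseteq> ?q ` topspace T"
      using r_coset_subset_G[OF W.subset f] topspace_eq_carrier by blast
    show "openin T (\<Union>g\<in>\<Gamma>. W #> (f \<otimes> g))"
      by (rule openin_Union) (use openin_r_coset[OF assms(2)] f in auto)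
  qed
  have cov: "topspace ?Q \<subseteq> \<Union>((\<lambda>f. ?q ` (W #> f)) ` carrier G)"
    using rcos_self[OF _ assms(1)] unfolding topspace_quotient_topology topspace_eq_carrier by blast
  have "\<exists>\<F>. finite \<F> \<and> \<F> \<subseteq> (\<lambda>f. ?q ` (W #> f)) ` carrier G \<and> topspace ?Q \<subseteq> \<Union>\<F>"
    using lattice op cov unfolding cocompact_lattice_def compact_space_alt by (metis (no_types, lifting) imageE)
  then obtain F where F: "finite F" "F \<subseteq> carrier G" "topspace ?Q \<subseteq> \<Union>((\<lambda>f. ?q ` (W #> f)) ` F)"
    using finite_subset_image[of _ "\<lambda>f. ?q ` (W #> f)" "carrier G"] by metis
  have "\<exists>w\<in>W. \<exists>f\<in>F. \<exists>g\<in>\<Gamma>. x = w \<otimes> f \<otimes> g" if x: "x \<in> carrier G" for x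
  proof -
    have "?q x \<in> topspace ?Q" using x unfolding topspace_quotient_topology topspace_eq_carrier by blast
    then obtain f where f: "f \<in> F" "?q x \<in> ?q ` (W #> f)" using F(3) by blast
    then have "x \<in> (\<Union>g\<in>\<Gamma>. W #> (f \<otimes> g))" using pre[of f] x F(2) topspace_eq_carrier by blast
    then obtain g w where g: "g \<in> \<Gamma>" "w \<in> W" "x = w \<otimes> (f \<otimes> g)" unfolding r_coset_def by blast
    then have "x = w \<otimes> f \<otimes> g" using f(1) F(2) by (simp add: m_assoc subset_iff)
    then show ?thesis using g f(1) by blast
  qed
  then show thesis by (rule that[OF F(1,2)])
qed

lemma finite_double_cosets:
  assumes "subgroup W G" "openin T W" and \<Gamma>': "subgroup \<Gamma>' G" "virtually_in \<Gamma> \<Gamma>'"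
  obtains F where "finite F" "F \<subseteq> carrier G"
    "\<And>x. x \<in> carrier G \<Longrightarrow> \<exists>w\<in>W. \<exists>f\<in>F. \<exists>g\<in>\<Gamma>'. x = w \<otimes> f \<otimes> g"
proof -
  interpret \<Gamma>: subgroup \<Gamma> G by (rule subgroup_lattice)
  interpret \<Gamma>': subgroup \<Gamma>' G by fact
  interpret W: subgroup W G by fact
  obtain F where F: "finite F" "F \<subseteq> carrier G"
      "\<And>x. x \<in> carrier G \<Longrightarrow> \<exists>w\<in>W. \<exists>f\<in>F. \<exists>g\<in>\<Gamma>. x = w \<otimes> f \<otimes> g"
    using finite_double_cosets_lattice[OF assms(1,2)] by metis
  obtain E where E: "finite E" "E \<subseteq> \<Gamma>" "\<And>g. g \<in> \<Gamma> \<Longrightarrow> \<exists>e\<in>E. g \<otimes> inv e \<in> \<Gamma>'"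
    using virtually_in_representatives[OF \<Gamma>'(2,1) \<Gamma>.subset] by blast
  let ?F = "(\<lambda>(f, e). f \<otimes> inv e) ` (F \<times> E)"
  have "\<exists>w\<in>W. \<exists>f\<in>?F. \<exists>g\<in>\<Gamma>'. x = w \<otimes> f \<otimes> g" if x: "x \<in> carrier G" for x
  proof -
    obtain w f g where w: "w \<in> W" "f \<in> F" "g \<in> \<Gamma>" "x = w \<otimes> f \<otimes> g" using F(3)[OF x] by blast
    obtain e where e: "e \<in> E" "inv g \<otimes> inv e \<in> \<Gamma>'" using E(3)[of "inv g"] w(3) by blast
    have c: "e \<in> carrier G" "f \<in> carrier G" using e w E(2) F(2) by auto
    have "inv (inv g \<otimes> inv e) \<in> \<Gamma>'" using e(2) by blast
    then have "e \<otimes> g \<in> \<Gamma>'" using c w(3) by (simp add: inv_mult_group)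
    moreover have "x = w \<otimes> (f \<otimes> inv e) \<otimes> (e \<otimes> g)"
      using c w by (simp add: m_assoc mult_inv_cancel_left)
    moreover have "f \<otimes> inv e \<in> ?F" using w(2) e(1) by force
    ultimately show ?thesis using w(1) by blast
  qed
  moreover have "finite ?F" "?F \<subseteq> carrier G"
    using F(1) E(1) subsetD[OF F(2)] subsetD[OF subset_trans[OF E(2) \<Gamma>.subset]] by auto
  ultimately show thesis using that[of ?F] by presburger
qed

text \<open>
  The double cosets of \<open>\<Lambda> \<inter> W\<close> and \<open>\<Gamma>'\<close> in \<open>\<Lambda>\<close> embed into those of \<open>W\<close> and \<open>\<Gamma>'\<close> in \<open>G\<close>: if \<open>wyh \<in> \<Lambda>\<close> with
  \<open>y \<in> \<Lambda>\<close> and \<open>h \<in> \<Gamma>' \<subseteq> \<Lambda>\<close>, then \<open>w \<in> \<Lambda>\<close>.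
\<close>

lemma finite_double_cosets_in_subgroup:
  assumes W: "subgroup W G" "openin T W"
    and \<Gamma>': "subgroup \<Gamma>' G" "virtually_in \<Gamma> \<Gamma>'"
    and \<Lambda>: "subgroup \<Lambda> G" "\<Gamma>' \<subseteq> \<Lambda>"
  obtains F where "finite F" "F \<subseteq> \<Lambda>"
    "\<And>x. x \<in> \<Lambda> \<Longrightarrow> \<exists>a\<in>\<Lambda> \<inter> W. \<exists>f\<in>F. \<exists>g\<in>\<Gamma>'. x = a \<otimes> f \<otimes> g"
proof -
  interpret \<Lambda>: subgroup \<Lambda> G by fact
  interpret \<Gamma>': subgroup \<Gamma>' G by fact
  interpret W: subgroup W G by fact
  obtain F where F: "finite F" "F \<subseteq> carrier G"
      "\<And>x. x \<in> carrier G \<Longrightarrow> \<exists>w\<in>W. \<exists>f\<in>F. \<exists>g\<in>\<Gamma>'. x = w \<otimes> f \<otimes> g"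
    using finite_double_cosets[OF W \<Gamma>'] by metis
  define meets where "meets f y \<longleftrightarrow> y \<in> \<Lambda> \<and> (\<exists>w\<in>W. \<exists>g\<in>\<Gamma>'. y = w \<otimes> f \<otimes> g)" for f y
  define F' where "F' = (\<lambda>f. SOME y. meets f y) ` {f \<in> F. \<exists>y. meets f y}"
  have finF': "finite F'" unfolding F'_def using F(1) by simp
  have some: "meets f (SOME y. meets f y)" if "\<exists>y. meets f y" for f using someI_ex[OF that] .
  then have F'\<Lambda>: "F' \<subseteq> \<Lambda>" unfolding F'_def meets_def by blast
  have "\<exists>a\<in>\<Lambda> \<inter> W. \<exists>f\<in>F'. \<exists>g\<in>\<Gamma>'. x = a \<otimes> f \<otimes> g" if x: "x \<in> \<Lambda>" for x
  proof -
    obtain w f g where w: "w \<in> W" "f \<in> F" "g \<in> \<Gamma>'" "x = w \<otimes> f \<otimes> g"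
      using F(3)[OF \<Lambda>.mem_carrier[OF x]] by blast
    define y where "y = (SOME y. meets f y)"
    have ex: "\<exists>y. meets f y" unfolding meets_def using x w by blast
    then have "meets f y" unfolding y_def by (rule some)
    then obtain v h where v: "y \<in> \<Lambda>" "v \<in> W" "h \<in> \<Gamma>'" "y = v \<otimes> f \<otimes> h" unfolding meets_def by blast
    have fc: "f \<in> carrier G" using w(2) F(2) by blast
    have eq: "x = (w \<otimes> inv v) \<otimes> y \<otimes> (inv h \<otimes> g)"
      unfolding w(4) v(4) using w v(2,3) fc by (simp add: m_assoc mult_inv_cancel_left)
    have c: "x \<in> carrier G" "y \<in> carrier G" using x v by auto
    have xy: "x \<otimes> inv (inv h \<otimes> g) \<otimes> inv y = w \<otimes> inv v"
      by (subst eq) (use c v(2,3) w(1,3) in \<open>simp add: m_assoc inv_mult_group mult_inv_cancel_left\<close>)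
    have "inv h \<otimes> g \<in> \<Lambda>" using subsetD[OF \<Lambda>(2)] v(3) w(3) by simp
    then have "x \<otimes> inv (inv h \<otimes> g) \<otimes> inv y \<in> \<Lambda>" using x v(1) by simp
    with xy have "w \<otimes> inv v \<in> \<Lambda> \<inter> W" using w(1) v(2) by simp
    moreover have "y \<in> F'" unfolding F'_def y_def using ex w(2) by blast
    moreover have "inv h \<otimes> g \<in> \<Gamma>'" using v(3) w(3) by blast
    ultimately show ?thesis using eq by blast
  qed
  then show thesis by (rule that[OF finF' F'\<Lambda>])
qed

text \<open>
  The stabilisers of \<open>\<Lambda> \<inter> W\<close> on \<open>\<Lambda>/\<Gamma>'\<close> are finite because a compact group contains only finitely many
  elements of the lattice. A finite index subgroup \<open>\<Gamma>'\<close> is allowed in place of \<open>\<Gamma>\<close>, since \<open>\<Lambda>\<close> will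
  later be generated by finite index subgroups and need not contain \<open>\<Gamma>\<close>.
\<close>

lemma finitely_generated_Int_compact_open:
  assumes \<Lambda>: "finite S" "S \<subseteq> carrier G" "generate G S = \<Lambda>"
    and \<Gamma>': "subgroup \<Gamma>' G" "\<Gamma>' \<subseteq> \<Lambda>" "\<Gamma>' \<subseteq> \<Gamma>" "virtually_in \<Gamma> \<Gamma>'"
    and comm: "\<And>t. t \<in> \<Lambda> \<Longrightarrow> virtually_in \<Gamma> (conjugate_set G t \<Gamma>)"
    and W: "subgroup W G" "compactin T W" "openin T W"
  shows "\<exists>R. finite R \<and> R \<subseteq> \<Lambda> \<inter> W \<and> generate G R = \<Lambda> \<inter> W"
proof -
  have sg\<Lambda>: "subgroup \<Lambda> G" using generate_is_subgroup[OF \<Lambda>(2)] \<Lambda>(3) by simp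
  obtain F where F: "finite F" "F \<subseteq> \<Lambda>"
      "\<And>x. x \<in> \<Lambda> \<Longrightarrow> \<exists>a\<in>\<Lambda> \<inter> W. \<exists>f\<in>F. \<exists>g\<in>\<Gamma>'. x = a \<otimes> f \<otimes> g"
    using finite_double_cosets_in_subgroup[OF W(1,3) \<Gamma>'(1,4) sg\<Lambda> \<Gamma>'(2)] by metis
  show ?thesis
  proof (rule finitely_generated_of_double_cosets[OF _ _ \<Gamma>'(1,2) \<Lambda> _ _ F])
    show "subgroup (\<Lambda> \<inter> W) G" by (rule subgroups_Inter_pair[OF sg\<Lambda> W(1)])
    show "\<Lambda> \<inter> W \<subseteq> \<Lambda>" by blast
    show "finite (\<Lambda> \<inter> W \<inter> \<Gamma>')"
      by (rule finite_subset[OF _ finite_lattice_Int_compact_subgroup[OF W(1,2)]]) (use \<Gamma>'(3) in blast)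
    show "virtually_in \<Gamma>' (conjugate_set G t \<Gamma>')" if t: "t \<in> \<Lambda>" for t
    proof (rule virtually_in_subset[OF _ \<Gamma>'(3)])
      have tc: "t \<in> carrier G" using t subgroup.subset[OF sg\<Lambda>] by blast
      show "virtually_in \<Gamma> (conjugate_set G t \<Gamma>')"
        by (rule virtually_in_trans[OF comm[OF t] virtually_in_conjugate[OF \<Gamma>'(4) subgroup_lattice \<Gamma>'(1) tc]])
          (use subgroup_conjugate_set[OF _ tc] subgroup_lattice \<Gamma>'(1) in blast)+
    qed
  qed
qed

text \<open>
  Since \<open>U\<close> is open, the finitely generated group \<open>\<Lambda> \<inter> U\<close> is dense in the intersection of \<open>U\<close> with the
  closure of \<open>\<Lambda>\<close>.
\<close>

lemma locally_finitely_generated_closure: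
  assumes \<Lambda>: "finite S" "S \<subseteq> carrier G" "generate G S = \<Lambda>" "\<Gamma> \<subseteq> \<Lambda>"
    and comm: "\<And>t. t \<in> \<Lambda> \<Longrightarrow> virtually_in \<Gamma> (conjugate_set G t \<Gamma>)"
  shows "locally_finitely_generated (G\<lparr>carrier := T closure_of \<Lambda>\<rparr>) (subtopology T (T closure_of \<Lambda>))"
proof -
  let ?J = "T closure_of \<Lambda>"
  have sg\<Lambda>: "subgroup \<Lambda> G" using generate_is_subgroup[OF \<Lambda>(2)] \<Lambda>(3) by simp
  have J: "subgroup ?J G" by (rule subgroup_closure_of[OF sg\<Lambda>])
  have \<Lambda>J: "\<Lambda> \<subseteq> ?J" using closure_of_subset subgroup.subset[OF sg\<Lambda>] topspace_eq_carrier by metis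
  have JU: "subgroup (?J \<inter> U) G" by (rule subgroups_Inter_pair[OF J U(1)])
  have JUc: "compactin T (?J \<inter> U)"
    using compact_Int_closedin[OF U(2) closedin_closure_of] by (simp add: Int_commute)
  have \<Lambda>U: "subgroup (\<Lambda> \<inter> U) G" by (rule subgroups_Inter_pair[OF sg\<Lambda> U(1)])
  obtain R where R: "finite R" "R \<subseteq> \<Lambda> \<inter> U" "generate G R = \<Lambda> \<inter> U"
    using finitely_generated_Int_compact_open[OF \<Lambda>(1-3) subgroup_lattice \<Lambda>(4) order_refl
      virtually_in_refl[OF subgroup_lattice] comm U(1-3)] by blast
  show ?thesis
    unfolding locally_finitely_generated_def fg_profinite_group_def
  proof (rule exI[of _ "?J \<inter> U"], intro conjI)
    show "subgroup (?J \<inter> U) (G\<lparr>carrier := ?J\<rparr>)" by (rule subgroup_incl[OF JU J]) blast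
    show "compactin (subtopology T ?J) (?J \<inter> U)" using JUc by (simp add: compactin_subtopology)
    show "openin (subtopology T ?J) (?J \<inter> U)" using U(3) by (simp add: openin_subtopology_Int2)
    have eq: "subtopology (subtopology T ?J) (?J \<inter> U) = subtopology T (?J \<inter> U)"
      by (simp add: subtopology_subtopology)
    show "profinite_group (G\<lparr>carrier := ?J, carrier := ?J \<inter> U\<rparr>) (subtopology (subtopology T ?J) (?J \<inter> U))"
      unfolding eq using profinite_group_compact_subgroup[OF JU JUc] by simp
    have dense: "subtopology T (?J \<inter> U) closure_of (\<Lambda> \<inter> U) = ?J \<inter> U"
    proof -
      have "subtopology T (?J \<inter> U) closure_of (\<Lambda> \<inter> U) = ?J \<inter> U \<inter> T closure_of (\<Lambda> \<inter> U)"
        by (rule closure_of_subtopology_open) (use \<Lambda>J in blast)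
      moreover have "U \<inter> ?J \<subseteq> T closure_of (U \<inter> \<Lambda>)" by (rule openin_Int_closure_of_subset[OF U(3)])
      ultimately show ?thesis by (auto simp: Int_commute)
    qed
    show "\<exists>D. subgroup D (G\<lparr>carrier := ?J, carrier := ?J \<inter> U\<rparr>) \<and>
        finitely_generated_group (G\<lparr>carrier := ?J, carrier := ?J \<inter> U, carrier := D\<rparr>) \<and>
        subtopology (subtopology T ?J) (?J \<inter> U) closure_of D
          = carrier (G\<lparr>carrier := ?J, carrier := ?J \<inter> U\<rparr>)"
      unfolding eq
    proof (rule exI[of _ "\<Lambda> \<inter> U"], intro conjI)
      show "subgroup (\<Lambda> \<inter> U) (G\<lparr>carrier := ?J, carrier := ?J \<inter> U\<rparr>)"
        using subgroup_incl[OF \<Lambda>U JU] \<Lambda>J by auto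
      show "finitely_generated_group (G\<lparr>carrier := ?J, carrier := ?J \<inter> U, carrier := \<Lambda> \<inter> U\<rparr>)"
        using finitely_generated_group_iff[OF \<Lambda>U] R by auto
      show "subtopology T (?J \<inter> U) closure_of (\<Lambda> \<inter> U) = carrier (G\<lparr>carrier := ?J, carrier := ?J \<inter> U\<rparr>)"
        unfolding dense by simp
    qed
  qed
qed

text \<open>
  Write \<open>inv g = w \<otimes> f \<otimes> h\<close> with \<open>w \<in> U\<close>, \<open>h \<in> \<Gamma>\<close> and \<open>f\<close> from a finite set. The stabiliser of the
  coset \<open>gU\<close> is the conjugate of \<open>U\<close> by \<open>g\<close>, and conjugating by \<open>h\<close>, which maps \<open>P\<close> into itself, bounds
  its index in \<open>A\<close> by an index that depends on \<open>f\<close> only. So the stabilisers in \<open>A\<close> have bounded index,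
  there are finitely many of them, and their intersection, which lies in the normal core of \<open>U\<close>, has
  finite index in \<open>A\<close>.
\<close>

lemma finite_of_finitely_generated_in_lattice_invariant_compact:
  assumes A: "finite S" "S \<subseteq> carrier G" "generate G S = A"
    and P: "subgroup P G" "compactin T P" "A \<subseteq> P"
    and inv: "\<And>g. g \<in> \<Gamma> \<Longrightarrow> conjugate_set G g P \<subseteq> P"
  shows "finite A"
proof -
  interpret \<Gamma>: subgroup \<Gamma> G by (rule subgroup_lattice)
  interpret U: subgroup U G by (rule U(1))
  interpret P: subgroup P G by fact
  have sgA: "subgroup A G" using generate_is_subgroup[OF A(2)] A(3) by simp
  obtain F where F: "finite F" "F \<subseteq> carrier G"
      "\<And>x. x \<in> carrier G \<Longrightarrow> \<exists>w\<in>U. \<exists>f\<in>F. \<exists>g\<in>\<Gamma>. x = w \<otimes> f \<otimes> g"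
    using finite_double_cosets_lattice[OF U(1,3)] by metis
  define B where "B f = conjugate_set G (inv f) U" for f
  have B: "subgroup (B f) G" "openin T (B f)" if "f \<in> F" for f
    unfolding B_def using that F(2) subgroup_conjugate_set[OF U(1)] openin_conjugate_set[OF U(3)]
    by (meson inv_closed subsetD)+
  define n where "n = (\<Sum>f\<in>F. card ((\<lambda>p. B f #> p) ` P))"
  have fin: "finite ((\<lambda>p. B f #> p) ` P)" if "f \<in> F" for f
    using compactin_imp_virtually_in_open[OF P(2) B(2,1)[OF that]] unfolding virtually_in_def .
  have main: "\<exists>f\<in>F. \<exists>d. (\<lambda>a. conjugate_set G g U #> a) ` A
      \<subseteq> (\<lambda>X. conjugate_set G d X) ` (\<lambda>p. B f #> p) ` P" if g: "g \<in> carrier G" for g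
  proof -
    obtain w f h where w: "w \<in> U" "f \<in> F" "h \<in> \<Gamma>" "inv g = w \<otimes> f \<otimes> h"
      using F(3)[OF inv_closed[OF g]] by blast
    have fc: "f \<in> carrier G" using w(2) F(2) by blast
    have "g = inv (w \<otimes> f \<otimes> h)" using w(4) inv_inv[OF g] by simp
    also have "\<dots> = inv h \<otimes> (inv f \<otimes> inv w)" using w(1-3) fc by (simp add: inv_mult_group)
    finally have gq: "g = inv h \<otimes> (inv f \<otimes> inv w)" .
    have "conjugate_set G g U
        = conjugate_set G (inv h) (conjugate_set G (inv f) (conjugate_set G (inv w) U))"
      unfolding gq using w fc U.subset by (simp add: conjugate_set_conjugate_set conjugate_set_subset_carrier)
    then have gU: "conjugate_set G g U = conjugate_set G (inv h) (B f)"
      unfolding B_def using conjugate_set_subgroup_self[OF U(1), of "inv w"] w(1) by simp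
    have "conjugate_set G g U #> a \<in> (\<lambda>X. conjugate_set G (inv h) X) ` (\<lambda>p. B f #> p) ` P"
      if a: "a \<in> A" for a
    proof -
      define p where "p = h \<otimes> a \<otimes> inv h"
      have ac: "a \<in> carrier G" using a P(3) P.subset by blast
      have p: "p \<in> P" unfolding p_def using inv[OF w(3)] a P(3) unfolding conjugate_set_image by blast
      have "inv h \<otimes> p \<otimes> inv (inv h) = a"
        unfolding p_def using ac w(3) by (simp add: m_assoc mult_inv_cancel_left)
      then have "conjugate_set G g U #> a = conjugate_set G (inv h) (B f #> p)"
        unfolding gU using conjugate_set_r_coset[of "B f" p "inv h"] subgroup.subset[OF B(1)[OF w(2)]]
          P.subset p w(3) by auto
      then show ?thesis using p by blast
    qed
    then show ?thesis using w(2) by blast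
  qed
  have "virtually_in A (\<Inter>((\<lambda>g. conjugate_set G g U) ` carrier G))"
  proof (rule virtually_in_Inter_of_bounded_index[OF A, where n = n])
    fix X assume "X \<in> (\<lambda>g. conjugate_set G g U) ` carrier G"
    then obtain g where g: "g \<in> carrier G" "X = conjugate_set G g U" by blast
    show "subgroup X G" using subgroup_conjugate_set[OF U(1)] g by blast
    obtain f d where f: "f \<in> F" "(\<lambda>a. X #> a) ` A
        \<subseteq> (\<lambda>X. conjugate_set G d X) ` (\<lambda>p. B f #> p) ` P" (is "_ \<subseteq> ?I")
      using main[OF g(1)] g(2) by blast
    have finI: "finite ?I" using fin[OF f(1)] by (rule finite_imageI)
    show "virtually_in A X" unfolding virtually_in_def using f(2) finI by (rule finite_subset)
    have "card ((\<lambda>a. X #> a) ` A) \<le> card ?I" by (rule card_mono[OF finI f(2)])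
    also have "\<dots> \<le> card ((\<lambda>p. B f #> p) ` P)" by (rule card_image_le[OF fin[OF f(1)]])
    also have "\<dots> \<le> n" unfolding n_def by (rule member_le_sum[OF f(1)]) (use F(1) in auto)
    finally show "card ((\<lambda>a. X #> a) ` A) \<le> n" .
  qed auto
  then show ?thesis
    using finite_if_virtually_in_finite[OF _ sgA] triv_subgroup U(4) unfolding normal_core_def by simp
qed

end

section \<open>Closed subgroups virtually containing the lattice and a commensurated subgroup\<close>

context core_free_cocompact_lattice
begin

definition approximants :: "'a set \<Rightarrow> 'a set set" where
  "approximants H = {L. subgroup L G \<and> closedin T L \<and> virtually_in \<Gamma> L \<and> virtually_in H L}"

lemma conjugate_set_approximant:
  assumes "L \<in> approximants H" "subgroup H G" "c \<in> carrier G"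
    and "virtually_in \<Gamma> (conjugate_set G c \<Gamma>)" "virtually_in H (conjugate_set G c H)"
  shows "conjugate_set G c L \<in> approximants H"
proof -
  have L: "subgroup L G" "closedin T L" "virtually_in \<Gamma> L" "virtually_in H L"
    using assms(1) unfolding approximants_def by auto
  have cO: "subgroup (conjugate_set G c L) G" by (rule subgroup_conjugate_set[OF L(1) assms(3)])
  have *: "virtually_in A (conjugate_set G c L)"
    if "virtually_in A (conjugate_set G c A)" "subgroup A G" "virtually_in A L" for A
    using virtually_in_trans[OF that(1) virtually_in_conjugate[OF that(3,2) L(1) assms(3)] that(2)
        subgroup_conjugate_set[OF that(2) assms(3)] cO] .
  show ?thesis
    unfolding approximants_def
    using cO closedin_conjugate_set[OF L(2) assms(3)] *[OF assms(4) subgroup_lattice L(3)]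
      *[OF assms(5,2) L(4)] by simp
qed

lemma Inter_approximants:
  assumes "finite \<F>" "\<F> \<noteq> {}" "\<F> \<subseteq> approximants H" "subgroup H G"
  shows "\<Inter>\<F> \<in> approximants H"
proof -
  have \<F>: "subgroup L G" "closedin T L" "virtually_in \<Gamma> L" "virtually_in H L" if "L \<in> \<F>" for L
    using assms(3) that unfolding approximants_def by auto
  have "subgroup (\<Inter>\<F>) G" by (rule subgroups_Inter[OF \<F>(1) assms(2)])
  moreover have "closedin T (\<Inter>\<F>)" by (rule closedin_Inter[OF assms(2) \<F>(2)])
  moreover have "virtually_in \<Gamma> (\<Inter>\<F>)"
    by (rule virtually_in_Inter[OF assms(1,2) subgroup.subset[OF subgroup_lattice] \<F>(1,3)])
  moreover have "virtually_in H (\<Inter>\<F>)"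
    by (rule virtually_in_Inter[OF assms(1,2) subgroup.subset[OF assms(4)] \<F>(1,4)])
  ultimately show ?thesis unfolding approximants_def by simp
qed

lemma approximantI:
  assumes "subgroup L G" "closedin T L" "\<Gamma> \<subseteq> L" "H \<subseteq> L"
  shows "L \<in> approximants H"
  using assms virtually_in_subset[OF virtually_in_refl[OF assms(1)]] unfolding approximants_def by blast

lemma approximants_nonempty:
  assumes "subgroup H G"
  shows "approximants H \<noteq> {}"
  using approximantI[OF subgroup_self, of H] subgroup.subset[OF assms]
    subgroup.subset[OF subgroup_lattice] closedin_topspace[of T] topspace_eq_carrier by auto

text \<open>
  Conjugation by \<open>C\<close> permutes the approximants, and the elements that conjugate a given \<open>m\<close> into a
  closed set form a closed set.
\<close>

lemma normal_Inter_approximants: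
  assumes H: "subgroup H G" and C: "subgroup C G" "T closure_of C = carrier G"
    and comm: "\<And>c. c \<in> C \<Longrightarrow> virtually_in \<Gamma> (conjugate_set G c \<Gamma>)"
      "\<And>c. c \<in> C \<Longrightarrow> virtually_in H (conjugate_set G c H)"
  shows "\<Inter>(approximants H) \<lhd> G" "closedin T (\<Inter>(approximants H))"
proof -
  interpret C: subgroup C G by fact
  let ?M = "\<Inter>(approximants H)"
  have sub: "subgroup L G" "closedin T L" if "L \<in> approximants H" for L
    using that unfolding approximants_def by auto
  note ne = approximants_nonempty[OF H]
  have M: "subgroup ?M G" by (rule subgroups_Inter[OF sub(1) ne])
  show cl: "closedin T ?M" by (rule closedin_Inter[OF ne sub(2)])
  have C_inv: "c \<otimes> m \<otimes> inv c \<in> ?M" if c: "c \<in> C" and m: "m \<in> ?M" for c m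
  proof
    fix L assume L: "L \<in> approximants H"
    have mc: "m \<in> carrier G" using m subgroup.subset[OF M] by blast
    have "conjugate_set G (inv c) L \<in> approximants H"
      using conjugate_set_approximant[OF L H] comm[of "inv c"] c by simp
    then have "m \<in> conjugate_set G (inv c) L" using m by blast
    then show "c \<otimes> m \<otimes> inv c \<in> L"
      using conjugate_set_iff[OF subgroup.subset[OF sub(1)[OF L]], of "inv c" m] c mc by simp
  qed
  have "g \<otimes> m \<otimes> inv g \<in> ?M" if g: "g \<in> carrier G" and m: "m \<in> ?M" for g m
  proof -
    have mc: "m \<in> carrier G" using m subgroup.subset[OF M] by blast
    have "closedin T {g \<in> topspace T. g \<otimes> m \<otimes> inv g \<in> ?M}"
      by (rule closedin_continuous_map_preimage[OF continuous_map_conjugate_element[OF mc] cl])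
    moreover have "C \<subseteq> {g \<in> topspace T. g \<otimes> m \<otimes> inv g \<in> ?M}"
      using C_inv[OF _ m] C.subset topspace_eq_carrier by auto
    ultimately have "T closure_of C \<subseteq> {g \<in> topspace T. g \<otimes> m \<otimes> inv g \<in> ?M}"
      by (rule closure_of_minimal[rotated])
    then show ?thesis using g C(2) by auto
  qed
  then show "?M \<lhd> G" using M unfolding normal_inv_iff by blast
qed

text \<open>
  If an element of \<open>W\<close> were conjugated by a generator of \<open>\<Gamma>\<close>, or its inverse, to an element of the
  intersection of all approximants outside \<open>W\<close>, then by normality it would lie in that intersection itself, and such
  elements of \<open>W\<close> stay in \<open>W\<close>. So the compact set \<open>Z\<close> of all conjugates that have left \<open>W\<close> misses the
  intersection of the approximants, hence misses a single one of them.
\<close>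

lemma lattice_invariant_approximant:
  assumes H: "subgroup H G"
    and S: "finite S" "S \<subseteq> carrier G" "generate G S = \<Gamma>"
    and comm: "\<And>c. c \<in> \<Gamma> \<Longrightarrow> virtually_in H (conjugate_set G c H)"
    and W: "subgroup W G" "compactin T W" "openin T W"
    and inv: "\<And>g x. g \<in> carrier G \<Longrightarrow> x \<in> W \<inter> \<Inter>(approximants H) \<Longrightarrow> g \<otimes> x \<otimes> inv g \<in> W"
    and normal: "\<Inter>(approximants H) \<lhd> G"
  obtains L where "L \<in> approximants H" "\<And>g. g \<in> \<Gamma> \<Longrightarrow> conjugate_set G g (L \<inter> W) \<subseteq> L \<inter> W"
proof -
  interpret \<Gamma>: subgroup \<Gamma> G by (rule subgroup_lattice)
  interpret W: subgroup W G by (rule W(1))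
  let ?M = "\<Inter>(approximants H)"
  have sub: "subgroup L G" "closedin T L" "virtually_in \<Gamma> L" if "L \<in> approximants H" for L
    using that unfolding approximants_def by auto
  note ne = approximants_nonempty[OF H]
  define S' where "S' = S \<union> (\<lambda>s. inv s) ` S"
  have "S \<subseteq> \<Gamma>" using S(3) generate.incl[of _ S G] by blast
  then have S': "finite S'" "S' \<subseteq> \<Gamma>" "S' \<subseteq> carrier G"
    unfolding S'_def using S(1) \<Gamma>.subset by auto
  define Z where "Z = (\<Union>s\<in>S'. conjugate_set G s W) - W"
  have "compactin T (\<Union>s\<in>S'. conjugate_set G s W)"
    by (rule compactin_Union) (use S' compactin_conjugate_set[OF W(2)] in auto)
  then have "compactin T ((\<Union>s\<in>S'. conjugate_set G s W) \<inter> (topspace T - W))"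
    by (rule compact_Int_closedin) (rule closedin_diff[OF closedin_topspace W(3)])
  moreover have Zc: "Z \<subseteq> carrier G"
    unfolding Z_def using conjugate_set_subset_carrier[OF W.subset] S'(3) by blast
  then have "Z = (\<Union>s\<in>S'. conjugate_set G s W) \<inter> (topspace T - W)"
    unfolding Z_def topspace_eq_carrier by blast
  ultimately have cptZ: "compactin T Z" by simp
  have ZM: "Z \<inter> ?M = {}"
  proof (rule ccontr)
    assume "Z \<inter> ?M \<noteq> {}"
    then obtain x where x: "x \<in> Z" "x \<in> ?M" by (meson disjoint_iff)
    then obtain s where s: "s \<in> S'" "x \<in> conjugate_set G s W" "x \<notin> W" unfolding Z_def by blast
    then obtain w where w: "w \<in> W" "x = s \<otimes> w \<otimes> inv s" unfolding conjugate_set_image by blast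
    have sc: "s \<in> carrier G" using s(1) S'(3) by blast
    have "inv s \<otimes> x \<otimes> inv (inv s) \<in> ?M"
      using normal x(2) inv_closed[OF sc] unfolding normal_inv_iff by blast
    then have "w \<in> ?M" unfolding w(2) using sc w(1) by (simp add: m_assoc mult_inv_cancel_left)
    then show False using inv[OF sc, of w] w s(3) by blast
  qed
  obtain \<F> where \<F>: "finite \<F>" "\<F> \<noteq> {}" "\<F> \<subseteq> approximants H" "Z \<inter> \<Inter>\<F> = {}"
    using compactin_Int_Inter_empty[OF cptZ ne sub(2) ZM] by blast
  define L0 where "L0 = \<Inter>\<F>"
  have L0: "L0 \<in> approximants H" unfolding L0_def by (rule Inter_approximants[OF \<F>(1-3) H])
  note L0_sub = sub(1)[OF L0] note L0c = subgroup.subset[OF L0_sub]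
  \<comment> \<open>Finitely many conjugates, since \<open>L0\<close> contains a finite index subgroup of \<open>\<Gamma>\<close>.\<close>
  define \<C> where "\<C> = (\<lambda>g. conjugate_set G g L0) ` \<Gamma>"
  have "finite ((\<lambda>a. L0 #> a) ` \<Gamma>)" using sub(3)[OF L0] unfolding virtually_in_def .
  then have "finite ((\<lambda>g. L0 #> inv g) ` \<Gamma>)" by (rule finite_subset[rotated]) auto
  then have "finite \<C>"
    unfolding \<C>_def
  proof (rule finite_image_coarser)
    fix g h assume gh: "g \<in> \<Gamma>" "h \<in> \<Gamma>" and "L0 #> inv g = L0 #> inv h"
    then have "inv g \<otimes> h \<in> L0" using r_coset_eq_iff[OF L0_sub, of "inv g" "inv h"] by simp
    then have "conjugate_set G g (conjugate_set G (inv g \<otimes> h) L0) = conjugate_set G g L0"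
      using conjugate_set_subgroup_self[OF L0_sub] by simp
    then show "conjugate_set G g L0 = conjugate_set G h L0"
      using gh L0c by (simp add: conjugate_set_conjugate_set mult_inv_cancel_left)
  qed
  moreover have "\<C> \<noteq> {}" unfolding \<C>_def using \<Gamma>.one_closed by blast
  moreover have "\<C> \<subseteq> approximants H"
  proof
    fix X assume "X \<in> \<C>"
    then obtain g where g: "g \<in> \<Gamma>" "X = conjugate_set G g L0" unfolding \<C>_def by blast
    have "virtually_in \<Gamma> (conjugate_set G g \<Gamma>)"
      using conjugate_set_subgroup_self[OF subgroup_lattice g(1)] virtually_in_refl[OF subgroup_lattice]
      by simp
    then show "X \<in> approximants H"
      using conjugate_set_approximant[OF L0 H _ _ comm[OF g(1)]] g by simp
  qed
  ultimately have L: "\<Inter>\<C> \<in> approximants H" by (rule Inter_approximants[OF _ _ _ H])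
  note Oc = subgroup.subset[OF sub(1)[OF L]]
  have "conjugate_set G \<one> L0 \<in> \<C>" unfolding \<C>_def using \<Gamma>.one_closed by blast
  then have OL0: "\<Inter>\<C> \<subseteq> L0" using conjugate_set_one[OF L0c] by auto
  have O_inv: "g \<otimes> x \<otimes> inv g \<in> \<Inter>\<C>" if g: "g \<in> \<Gamma>" and x: "x \<in> \<Inter>\<C>" for g x
    unfolding \<C>_def
  proof (rule INT_I)
    fix h assume h: "h \<in> \<Gamma>"
    have xc: "x \<in> carrier G" using x Oc by blast
    have "inv g \<otimes> h \<in> \<Gamma>" using g h by simp
    then have "x \<in> conjugate_set G (inv g \<otimes> h) L0" using x unfolding \<C>_def by blast
    then show "g \<otimes> x \<otimes> inv g \<in> conjugate_set G h L0"
      using g h xc conjugate_set_iff[OF L0c, of "inv g \<otimes> h" x] conjugate_set_iff[OF L0c, of h]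
      by (simp add: inv_mult_group m_assoc)
  qed
  define P where "P = \<Inter>\<C> \<inter> W"
  have Pc: "P \<subseteq> carrier G" unfolding P_def using W.subset by blast
  have gen: "s \<otimes> x \<otimes> inv s \<in> P" if s: "s \<in> S'" and x: "x \<in> P" for s x
  proof -
    have y: "s \<otimes> x \<otimes> inv s \<in> \<Inter>\<C>" using O_inv[of s x] s x S'(2) unfolding P_def by blast
    have "s \<otimes> x \<otimes> inv s \<in> conjugate_set G s W" unfolding conjugate_set_image using x P_def by blast
    moreover have "s \<otimes> x \<otimes> inv s \<notin> Z" using y OL0 \<F>(4) unfolding L0_def by blast
    ultimately have "s \<otimes> x \<otimes> inv s \<in> W" unfolding Z_def using s by blast
    then show ?thesis unfolding P_def using y by blast
  qed
  have "g \<otimes> x \<otimes> inv g \<in> P" if "g \<in> generate G S" "x \<in> P" for g x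
    using that
  proof (induction g arbitrary: x rule: generate.induct)
    case one
    then show ?case using Pc by (simp add: subset_iff)
  next
    case (incl s)
    then show ?case using gen unfolding S'_def by blast
  next
    case (inv s)
    then show ?case using gen unfolding S'_def by blast
  next
    case (eng g h)
    have c: "g \<in> carrier G" "h \<in> carrier G" "x \<in> carrier G"
      using eng.hyps generate_in_carrier[OF S(2)] eng.prems Pc by blast+
    have "g \<otimes> (h \<otimes> x \<otimes> inv h) \<otimes> inv g \<in> P" by (rule eng.IH(1)[OF eng.IH(2)[OF eng.prems]])
    then show ?case using c by (simp add: m_assoc inv_mult_group)
  qed
  then have "conjugate_set G g P \<subseteq> P" if "g \<in> \<Gamma>" for g
    using that S(3) unfolding conjugate_set_image by blast
  then show thesis unfolding P_def by (rule that[OF L])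
qed

text \<open>
  The subgroup \<open>\<Lambda>\<close> generated by \<open>\<Gamma> \<inter> L\<close> and \<open>H \<inter> L\<close> lies in \<open>L\<close>, so \<open>\<Lambda> \<inter> W\<close> is a finitely generated
  subgroup of a compact group normalised by \<open>\<Gamma>\<close>, and therefore finite. Thus the finitely many double
  cosets of \<open>\<Lambda> \<inter> W\<close> and \<open>\<Gamma> \<inter> L\<close> in \<open>\<Lambda>\<close> are finitely many cosets of \<open>\<Gamma> \<inter> L\<close>.
\<close>

lemma virtually_in_lattice_of_invariant_approximant:
  assumes H: "subgroup H G" "finite S\<^sub>H" "S\<^sub>H \<subseteq> carrier G" "generate G S\<^sub>H = H"
    and S: "finite S" "S \<subseteq> carrier G" "generate G S = \<Gamma>"
    and comm: "\<And>t. t \<in> generate G (\<Gamma> \<union> H) \<Longrightarrow> virtually_in \<Gamma> (conjugate_set G t \<Gamma>)"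
    and W: "subgroup W G" "compactin T W" "openin T W"
    and L: "L \<in> approximants H" and inv: "\<And>g. g \<in> \<Gamma> \<Longrightarrow> conjugate_set G g (L \<inter> W) \<subseteq> L \<inter> W"
  shows "virtually_in H \<Gamma>"
proof -
  have L': "subgroup L G" "closedin T L" "virtually_in \<Gamma> L" "virtually_in H L"
    using L unfolding approximants_def by auto
  let ?\<Gamma>' = "\<Gamma> \<inter> L" and ?H' = "H \<inter> L"
  have \<Gamma>': "subgroup ?\<Gamma>' G" by (rule subgroups_Inter_pair[OF subgroup_lattice L'(1)])
  have H': "subgroup ?H' G" by (rule subgroups_Inter_pair[OF H(1) L'(1)])
  note \<Gamma>c = subgroup.subset[OF subgroup_lattice] and Hc = subgroup.subset[OF H(1)]
  have v\<Gamma>: "virtually_in \<Gamma> ?\<Gamma>'"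
    by (rule virtually_in_Int[OF virtually_in_refl[OF subgroup_lattice] L'(3) subgroup_lattice L'(1) \<Gamma>c])
  have vH: "virtually_in H ?H'"
    by (rule virtually_in_Int[OF virtually_in_refl[OF H(1)] L'(4) H(1) L'(1) Hc])
  obtain R1 where R1: "finite R1" "R1 \<subseteq> ?\<Gamma>'" "generate G R1 = ?\<Gamma>'"
    using finitely_generated_finite_index[OF \<Gamma>' Int_lower1 S v\<Gamma>] by blast
  obtain R2 where R2: "finite R2" "R2 \<subseteq> ?H'" "generate G R2 = ?H'"
    using finitely_generated_finite_index[OF H' Int_lower1 H(2-4) vH] by blast
  define \<Lambda> where "\<Lambda> = generate G (R1 \<union> R2)"
  have Rc: "finite (R1 \<union> R2)" "R1 \<union> R2 \<subseteq> carrier G" using R1 R2 \<Gamma>c Hc by blast+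
  have sg\<Lambda>: "subgroup \<Lambda> G" unfolding \<Lambda>_def by (rule generate_is_subgroup[OF Rc(2)])
  have \<Gamma>'\<Lambda>: "?\<Gamma>' \<subseteq> \<Lambda>" unfolding \<Lambda>_def R1(3)[symmetric] by (rule mono_generate) blast
  have H'\<Lambda>: "?H' \<subseteq> \<Lambda>" unfolding \<Lambda>_def R2(3)[symmetric] by (rule mono_generate) blast
  have \<Lambda>L: "\<Lambda> \<subseteq> L" unfolding \<Lambda>_def by (rule generate_subgroup_incl[OF _ L'(1)]) (use R1 R2 in blast)
  have \<Lambda>c: "virtually_in \<Gamma> (conjugate_set G t \<Gamma>)" if "t \<in> \<Lambda>" for t
  proof (rule comm)
    have "\<Lambda> \<subseteq> generate G (\<Gamma> \<union> H)" unfolding \<Lambda>_def by (rule mono_generate) (use R1 R2 in blast)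
    then show "t \<in> generate G (\<Gamma> \<union> H)" using that by blast
  qed
  have sg: "subgroup (\<Lambda> \<inter> W) G" by (rule subgroups_Inter_pair[OF sg\<Lambda> W(1)])
  obtain R where R: "finite R" "R \<subseteq> \<Lambda> \<inter> W" "generate G R = \<Lambda> \<inter> W"
    using finitely_generated_Int_compact_open[OF Rc \<Lambda>_def[symmetric] \<Gamma>' \<Gamma>'\<Lambda> Int_lower1 v\<Gamma> \<Lambda>c W]
    by blast
  have "finite (\<Lambda> \<inter> W)"
  proof (rule finite_of_finitely_generated_in_lattice_invariant_compact[OF R(1) _ R(3)])
    show "R \<subseteq> carrier G" using R(2) subgroup.subset[OF sg] by blast
    show "subgroup (L \<inter> W) G" by (rule subgroups_Inter_pair[OF L'(1) W(1)])
    show "compactin T (L \<inter> W)" using compact_Int_closedin[OF W(2) L'(2)] by (simp add: Int_commute)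
    show "\<Lambda> \<inter> W \<subseteq> L \<inter> W" using \<Lambda>L by blast
  qed (rule inv)
  obtain F where F: "finite F" "F \<subseteq> \<Lambda>"
      "\<And>x. x \<in> \<Lambda> \<Longrightarrow> \<exists>a\<in>\<Lambda> \<inter> W. \<exists>f\<in>F. \<exists>g\<in>?\<Gamma>'. x = a \<otimes> f \<otimes> g"
    using finite_double_cosets_in_subgroup[OF W(1,3) \<Gamma>' v\<Gamma> sg\<Lambda> \<Gamma>'\<Lambda>] by metis
  have "virtually_in \<Lambda> ?\<Gamma>'"
  proof (rule virtually_inI_representatives[OF \<Gamma>'])
    note \<Lambda>cc = subgroup.subset[OF sg\<Lambda>]
    show "\<Lambda> \<subseteq> carrier G" by (rule \<Lambda>cc)
    let ?E = "(\<lambda>(a, f). inv (a \<otimes> f)) ` ((\<Lambda> \<inter> W) \<times> F)"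
    show "finite ?E" using \<open>finite (\<Lambda> \<inter> W)\<close> F(1) by blast
    show "?E \<subseteq> carrier G" using subsetD[OF \<Lambda>cc] subsetD[OF F(2)] by auto
    fix x assume x: "x \<in> \<Lambda>"
    have xc: "x \<in> carrier G" using x \<Lambda>cc by blast
    obtain a f g where a: "a \<in> \<Lambda> \<inter> W" "f \<in> F" "g \<in> ?\<Gamma>'" "inv x = a \<otimes> f \<otimes> g"
      using F(3)[OF subgroup.m_inv_closed[OF sg\<Lambda> x]] by blast
    have c: "a \<in> carrier G" "f \<in> carrier G" "g \<in> carrier G" using a F(2) \<Lambda>cc \<Gamma>c by blast+
    have "x = inv (a \<otimes> f \<otimes> g)" using a(4) inv_inv[OF xc] by simp
    then have "x \<otimes> inv (inv (a \<otimes> f)) = inv g"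
      using c by (simp add: inv_mult_group m_assoc mult_inv_cancel_left)
    then have "x \<otimes> inv (inv (a \<otimes> f)) \<in> ?\<Gamma>'" using subgroup.m_inv_closed[OF \<Gamma>' a(3)] by simp
    moreover have "inv (a \<otimes> f) \<in> ?E" using a(1,2) by (intro image_eqI[where x = "(a, f)"]) auto
    ultimately show "\<exists>e\<in>?E. x \<otimes> inv e \<in> ?\<Gamma>'" by blast
  qed
  then have "virtually_in ?H' ?\<Gamma>'" by (rule virtually_in_subset[OF _ H'\<Lambda>])
  then have "virtually_in H ?\<Gamma>'" by (rule virtually_in_trans[OF vH _ H(1) H' \<Gamma>'])
  then show ?thesis by (rule virtually_in_superset[OF _ \<Gamma>' subgroup_lattice Hc Int_lower1])
qed

text \<open>
  Take a compact open subgroup whose intersection with \<open>M\<close> lies in \<open>K\<close>, and multiply it by the compact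
  normal subgroup \<open>K\<close>.
\<close>

lemma compact_open_subgroup_with_prescribed_trace:
  assumes K: "K \<lhd> G" "compactin T K" "K \<subseteq> M" "openin (subtopology T M) K" and M: "subgroup M G"
  obtains W where "subgroup W G" "compactin T W" "openin T W" "W \<inter> M = K"
proof -
  interpret K: normal K G by (rule K(1))
  interpret M: subgroup M G by (rule M)
  obtain V where V: "openin T V" "K = V \<inter> M" using K(4) unfolding openin_subtopology by blast
  have "\<one> \<in> V" using K.one_closed V(2) by blast
  then obtain W where W: "subgroup W G" "compactin T W" "openin T W" "W \<subseteq> V"
    using small_compact_open_subgroup[OF V(1)] by blast
  interpret W: subgroup W G by (rule W(1))
  have Kinv: "g \<otimes> k \<otimes> inv g \<in> K" if "g \<in> carrier G" "k \<in> K" for g k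
    using K(1)[unfolded normal_inv_iff] that by simp
  let ?P = "(\<lambda>(w, k). w \<otimes> k) ` (W \<times> K)"
  have P_I: "w \<otimes> k \<in> ?P" if "w \<in> W" "k \<in> K" for w k
    using that by (intro image_eqI[of _ _ "(w, k)"]) auto
  have "subgroup ?P G"
  proof
    show "?P \<subseteq> carrier G" using W.subset K.subset by auto
    show "\<one> \<in> ?P" using P_I[OF W.one_closed K.one_closed] by simp
  next
    fix x y assume "x \<in> ?P" "y \<in> ?P"
    then obtain w k v l where wk: "w \<in> W" "k \<in> K" "v \<in> W" "l \<in> K" "x = w \<otimes> k" "y = v \<otimes> l" by auto
    have "x \<otimes> y = (w \<otimes> v) \<otimes> ((inv v \<otimes> k \<otimes> inv (inv v)) \<otimes> l)"
      unfolding wk(5,6) using wk(1-4) by (simp add: m_assoc mult_inv_cancel_left)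
    moreover have "(inv v \<otimes> k \<otimes> inv (inv v)) \<otimes> l \<in> K" using Kinv[of "inv v" k] wk(2-4) by simp
    moreover have "w \<otimes> v \<in> W" using wk(1,3) by simp
    ultimately show "x \<otimes> y \<in> ?P" using P_I by simp
  next
    fix x assume "x \<in> ?P"
    then obtain w k where wk: "w \<in> W" "k \<in> K" "x = w \<otimes> k" by auto
    have "inv x = inv w \<otimes> (w \<otimes> inv k \<otimes> inv w)"
      unfolding wk(3) using wk(1,2) by (simp add: inv_mult_group m_assoc mult_inv_cancel_left)
    moreover have "w \<otimes> inv k \<otimes> inv w \<in> K" using Kinv[of w "inv k"] wk(1,2) by simp
    ultimately show "inv x \<in> ?P" using P_I wk(1) by simp
  qed
  moreover have "compactin T ?P"
    by (rule image_compactin[OF _ continuous_map_mult]) (use W(2) K(2) in \<open>simp add: compactin_Times\<close>)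
  moreover have "openin T ?P"
  proof -
    have "?P = \<Union>((\<lambda>k. W #> k) ` K)" unfolding r_coset_def by auto
    moreover have "openin T (\<Union>((\<lambda>k. W #> k) ` K))"
      by (rule openin_Union) (use openin_r_coset[OF W(3)] in auto)
    ultimately show ?thesis by simp
  qed
  moreover have "?P \<inter> M = K"
  proof
    show "?P \<inter> M \<subseteq> K"
    proof
      fix x assume "x \<in> ?P \<inter> M"
      then obtain w k where wk: "w \<in> W" "k \<in> K" "x = w \<otimes> k" "x \<in> M" by auto
      have "w = x \<otimes> inv k" using wk by (simp add: m_assoc)
      then have "w \<in> M" using wk(4) subsetD[OF K(3) wk(2)] by simp
      then have "w \<in> K" using wk(1) W(4) V(2) by blast
      then show "x \<in> K" using wk(2,3) by simp
    qed
    have "k \<in> ?P" if "k \<in> K" for k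
      using P_I[OF W.one_closed that] K.mem_carrier[OF that] by simp
    then show "K \<subseteq> ?P \<inter> M" using K(3) by blast
  qed
  ultimately show thesis by (rule that)
qed

end

section \<open>Commensurated subgroups\<close>

theorem theorem4p4:
  fixes G :: "('a, 'm) monoid_scheme" and T :: "'a topology" and \<Gamma> C :: "'a set"
  assumes "tdlc_group G T"
    and "cocompact_lattice G T \<Gamma>"
    and "finitely_generated_group (G\<lparr>carrier := \<Gamma>\<rparr>)"
    and "subgroup C G" and "T closure_of C = carrier G"
    and "\<Gamma> \<subseteq> C" and "C \<subseteq> commensurator G \<Gamma>"
    and "\<exists>U. subgroup U G \<and> compactin T U \<and> openin T U \<and> normal_core G U = {\<one>\<^bsub>G\<^esub>}"
    and "\<And>N. N \<lhd> G \<Longrightarrow> closedin T N \<Longrightarrow>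
           (\<exists>K. subgroup K G \<and> K \<subseteq> N \<and> compactin T K \<and> openin (subtopology T N) K \<and> K \<lhd> G)
           \<or> discrete_residual G T \<subseteq> N"
    and "\<And>J. subgroup J G \<Longrightarrow> closedin T J \<Longrightarrow> discrete_residual G T \<subseteq> J \<Longrightarrow>
           \<not> locally_finitely_generated (G\<lparr>carrier := J\<rparr>) (subtopology T J)"
  shows "\<And>H. subgroup H (G\<lparr>carrier := C\<rparr>) \<Longrightarrow> finitely_generated_group (G\<lparr>carrier := H\<rparr>) \<Longrightarrow>
           commensurated (G\<lparr>carrier := C\<rparr>) H \<Longrightarrow> virtually_contained G H \<Gamma>"
proof -
  fix H
  assume H_C: "subgroup H (G\<lparr>carrier := C\<rparr>)" and H_fg: "finitely_generated_group (G\<lparr>carrier := H\<rparr>)"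
    and H_comm: "commensurated (G\<lparr>carrier := C\<rparr>) H"
  interpret tdlc_group G T by (rule assms(1))
  obtain U where U: "subgroup U G" "compactin T U" "openin T U" "normal_core G U = {\<one>\<^bsub>G\<^esub>}"
    using assms(8) by blast
  interpret core_free_cocompact_lattice G T U \<Gamma>
    by (intro core_free_cocompact_lattice.intro core_free_cocompact_lattice_axioms.intro)
      (rule assms(1,2) U)+
  interpret C: subgroup C G by (rule assms(4))
  note \<Gamma> = subgroup_lattice
  have HC: "H \<subseteq> C" using subgroup.subset[OF H_C] by simp
  have H: "subgroup H G" by (rule incl_subgroup[OF assms(4) H_C])
  obtain S where S: "finite S" "S \<subseteq> \<Gamma>" "generate G S = \<Gamma>"
    using assms(3) finitely_generated_group_iff[OF \<Gamma>] by blast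
  obtain R where R: "finite R" "R \<subseteq> H" "generate G R = H"
    using H_fg finitely_generated_group_iff[OF H] by blast
  have Sc: "S \<subseteq> carrier G" and Rc: "R \<subseteq> carrier G"
    using S(2) R(2) subgroup.subset[OF \<Gamma>] subgroup.subset[OF H] by blast+
  have comm\<Gamma>: "virtually_in \<Gamma> (conjugate_set G c \<Gamma>)" if "c \<in> C" for c
    using commensurable_imp_virtually_in[OF \<Gamma> subgroup_conjugate_set[OF \<Gamma>]] assms(7) that
    unfolding commensurator_def by blast
  have commH: "virtually_in H (conjugate_set G c H)" if c: "c \<in> C" for c
  proof -
    have "conjugate_set (G\<lparr>carrier := C\<rparr>) c H = conjugate_set G c H"
      unfolding conjugate_set_def using m_inv_consistent[OF assms(4) c] by simp
    moreover have "commensurable (G\<lparr>carrier := C\<rparr>) H (conjugate_set (G\<lparr>carrier := C\<rparr>) c H)"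
      using H_comm c unfolding commensurated_def by simp
    ultimately have "commensurable G H (conjugate_set G c H)"
      unfolding commensurable_def finite_index_subgroup_def by simp
    then show ?thesis
      using commensurable_imp_virtually_in[OF H subgroup_conjugate_set[OF H]] c by simp
  qed
  let ?M = "\<Inter>(approximants H)"
  have M: "?M \<lhd> G" "closedin T ?M"
    by (rule normal_Inter_approximants[OF H assms(4,5) comm\<Gamma> commH]; assumption)+
  have sgM: "subgroup ?M G" using M(1) unfolding normal_inv_iff by blast
  define \<Lambda> where "\<Lambda> = generate G (S \<union> R)"
  have sg\<Lambda>: "subgroup \<Lambda> G" unfolding \<Lambda>_def by (rule generate_is_subgroup) (use Sc Rc in blast)
  have \<Gamma>\<Lambda>: "\<Gamma> \<subseteq> \<Lambda>" unfolding \<Lambda>_def S(3)[symmetric] by (rule mono_generate) blast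
  have H\<Lambda>: "H \<subseteq> \<Lambda>" unfolding \<Lambda>_def R(3)[symmetric] by (rule mono_generate) blast
  have \<Lambda>C: "\<Lambda> \<subseteq> C"
    unfolding \<Lambda>_def by (rule generate_subgroup_incl[OF _ assms(4)]) (use S R HC assms(6) in blast)
  let ?J = "T closure_of \<Lambda>"
  have J: "subgroup ?J G" by (rule subgroup_closure_of[OF sg\<Lambda>])
  have \<Lambda>J: "\<Lambda> \<subseteq> ?J" using closure_of_subset subgroup.subset[OF sg\<Lambda>] topspace_eq_carrier by metis
  have "?J \<in> approximants H"
    by (rule approximantI[OF J closedin_closure_of]) (use \<Lambda>J \<Gamma>\<Lambda> H\<Lambda> in blast)+
  then have MJ: "?M \<subseteq> ?J" by blast
  have "locally_finitely_generated (G\<lparr>carrier := ?J\<rparr>) (subtopology T ?J)"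
  proof (rule locally_finitely_generated_closure[OF _ _ \<Lambda>_def[symmetric] \<Gamma>\<Lambda>])
    show "finite (S \<union> R)" "S \<union> R \<subseteq> carrier G" using S(1) R(1) Sc Rc by blast+
    show "virtually_in \<Gamma> (conjugate_set G t \<Gamma>)" if "t \<in> \<Lambda>" for t using comm\<Gamma> \<Lambda>C that by blast
  qed
  then have "\<not> discrete_residual G T \<subseteq> ?J" using assms(10)[OF J closedin_closure_of] by blast
  then have "\<not> discrete_residual G T \<subseteq> ?M" using MJ by blast
  then obtain K where K: "K \<subseteq> ?M" "compactin T K" "openin (subtopology T ?M) K" "K \<lhd> G"
    using assms(9)[OF M] by blast
  obtain W where W: "subgroup W G" "compactin T W" "openin T W" "W \<inter> ?M = K"
    using compact_open_subgroup_with_prescribed_trace[OF K(4,2,1,3) sgM] by blast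
  have commH\<Gamma>: "virtually_in H (conjugate_set G c H)" if "c \<in> \<Gamma>" for c
    using commH assms(6) that by blast
  have invW: "g \<otimes>\<^bsub>G\<^esub> x \<otimes>\<^bsub>G\<^esub> inv\<^bsub>G\<^esub> g \<in> W" if "g \<in> carrier G" "x \<in> W \<inter> ?M" for g x
  proof -
    have "g \<otimes>\<^bsub>G\<^esub> x \<otimes>\<^bsub>G\<^esub> inv\<^bsub>G\<^esub> g \<in> K" using K(4) W(4) that unfolding normal_inv_iff by blast
    then show ?thesis using W(4) by blast
  qed
  obtain L where L: "L \<in> approximants H" "\<And>g. g \<in> \<Gamma> \<Longrightarrow> conjugate_set G g (L \<inter> W) \<subseteq> L \<inter> W"
    using lattice_invariant_approximant[OF H S(1) Sc S(3) commH\<Gamma> W(1-3) invW M(1)] by metis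
  have "virtually_in H \<Gamma>"
  proof (rule virtually_in_lattice_of_invariant_approximant[OF H R(1) Rc R(3) S(1) Sc S(3) _ W(1-3) L])
    show "virtually_in \<Gamma> (conjugate_set G t \<Gamma>)" if "t \<in> generate G (\<Gamma> \<union> H)" for t
    proof (rule comm\<Gamma>)
      have "generate G (\<Gamma> \<union> H) \<subseteq> C"
        by (rule generate_subgroup_incl[OF _ assms(4)]) (use HC assms(6) in blast)
      then show "t \<in> C" using that by blast
    qed
  qed
  then have "virtually_in H (H \<inter> \<Gamma>)"
    by (rule virtually_in_Int[OF virtually_in_refl[OF H] _ H \<Gamma> subgroup.subset[OF H]])
  then have "finite_index_subgroup (H \<inter> \<Gamma>) (G\<lparr>carrier := H\<rparr>)"
    using finite_index_subgroup_iff[OF H subgroups_Inter_pair[OF H \<Gamma>] Int_lower1] by simp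
  then show "virtually_contained G H \<Gamma>"
    unfolding virtually_contained_def by blast
qed

end
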